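(* Let $K$ be a principal $n$-complex and let $\pi\in\Sigma_{n+1}$. If the underlying space $|K|$ is a PL manifold, then for every $i$ (with $0\le i\le n$) the natural map $\phi\colon H^\pi_i(K)\to H_i(K)$ is an isomorphism.
   Context: A complex is a locally finite simplicial complex. A principal $n$-complex is a complex in which each simplex is a face of an $n$-simplex. $K^{(1)}$ is the barycentric first derived subdivision of $K$. $\Sigma_{n+1}$ is the group of permutations of $\{0,1,\ldots,n\}$. For $\pi\in\Sigma_{n+1}$ and $0\le i\le n$, $K^\pi_i$ is the full subcomplex of $K^{(1)}$ generated by the barycentres of those simplexes of $K$ whose dimension lies in $\{\pi(0),\ldots,\pi(i)\}$; it is a principal $i$-complex and $K^\pi_i\subset K^\pi_{i+1}$. Conventions: $K^\pi_i=\emptyset$ for $i<0$ and $K^\pi_i=K^\pi_n=K^{(1)}$ for $i>n$. The $i$-th permutation homology group $H^\pi_i(K)$ is the $i$-th homology group of the chain complex $$\cdots\to H_{i+1}(K^\pi_{i+1},K^\pi_i)\xrightarrow{\partial} H_i(K^\pi_i,K^\pi_{i-1})\xrightarrow{\partial} H_{i-1}(K^\pi_{i-1},K^\pi_{i-2})\to\cdots$$ whose boundary maps come from the homology exact sequences of the appropriate triples ($H_*$ is ordinary integral homology). Equivalently, $H^\pi_i(K)\cong \operatorname{Im}(H_i(K^\pi_i)\to H_i(K^\pi_{i+1}))$, i.e. $i$-cycles in $|K^\pi_i|$ modulo homologies in $|K^\pi_{i+1}|$. The natural map $\phi\colon H^\pi_i(K)\to H_i(K)$ sends the class of an $i$-cycle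 in $|K^\pi_i|$ to its homology class in $|K|$. *)

theory Defs
  imports
    "HOL-Analysis.Analysis"
    "HOL-Homology.Homology"
    "HOL-Combinatorics.Combinatorics"
begin

section \<open>Complexes and their underlying spaces\<close>

definition simplicial_complex :: "'v set set \<Rightarrow> bool" where
  "simplicial_complex K \<longleftrightarrow>
     (\<forall>\<sigma>\<in>K. finite \<sigma> \<and> \<sigma> \<noteq> {}) \<and>
     (\<forall>\<sigma>\<in>K. \<forall>\<tau>. \<tau> \<subseteq> \<sigma> \<and> \<tau> \<noteq> {} \<longrightarrow> \<tau> \<in> K)"

definition locally_finite :: "'v set set \<Rightarrow> bool" where
  "locally_finite K \<longleftrightarrow> (\<forall>v. finite {\<sigma> \<in> K. v \<in> \<sigma>})"

definition simplex_dim :: "'v set \<Rightarrow> nat" where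
  "simplex_dim \<sigma> = card \<sigma> - 1"

definition principal_complex :: "nat \<Rightarrow> 'v set set \<Rightarrow> bool" where
  "principal_complex n K \<longleftrightarrow>
     simplicial_complex K \<and> locally_finite K \<and>
     (\<forall>\<sigma>\<in>K. \<exists>\<tau>\<in>K. \<sigma> \<subseteq> \<tau> \<and> simplex_dim \<tau> = n)"

definition supp :: "('v \<Rightarrow> real) \<Rightarrow> 'v set" where
  "supp x = {v. x v \<noteq> 0}"

text \<open>
  Points of the underlying space are given by their barycentric coordinates.  Function types carry
  the topology of pointwise convergence.  On the underlying space of a locally finite complex it
  induces the weak topology: the open star of a simplex is open in it and lies in a finite
  subcomplex.
\<close>

definition realization :: "'v set set \<Rightarrow> ('v \<Rightarrow> real) set" where
  "realization K = {x. (\<forall>v. 0 \<le> x v) \<and> supp x \<in> K \<and> (\<Sum>v\<in>supp x. x v) = 1}"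

section \<open>The first derived subdivision and the complexes of a permutation\<close>

text \<open>
  A simplex of the first derived is a chain of simplexes of \<open>K\<close>; a vertex \<open>\<sigma>\<close> of it stands for the
  barycentre of \<open>\<sigma>\<close>.
\<close>

definition derived :: "'v set set \<Rightarrow> 'v set set set" where
  "derived K = {c. c \<subseteq> K \<and> finite c \<and> c \<noteq> {} \<and> (\<forall>\<sigma>\<in>c. \<forall>\<tau>\<in>c. \<sigma> \<subseteq> \<tau> \<or> \<tau> \<subseteq> \<sigma>)}"

definition barycentre :: "'v set \<Rightarrow> 'v \<Rightarrow> real" where
  "barycentre \<sigma> = (\<lambda>v. if v \<in> \<sigma> then 1 / real (card \<sigma>) else 0)"

text \<open>The underlying space of a subcomplex of the first derived of \<open>K\<close>, as a subset of \<open>|K|\<close>.\<close>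

definition derived_space :: "'v set set set \<Rightarrow> ('v \<Rightarrow> real) set" where
  "derived_space L =
     (\<lambda>t v. \<Sum>\<sigma>\<in>supp t. t \<sigma> * barycentre \<sigma> v) ` realization L"

text \<open>
  The index ranges over all integers.  If \<open>\<pi>\<close> permutes \<open>{0..n}\<close> and \<open>K\<close> has no simplexes of dimension
  above \<open>n\<close>, this gives the empty complex for \<open>i < 0\<close> and the whole first derived for \<open>i \<ge> n\<close>.
\<close>

definition perm_complex :: "'v set set \<Rightarrow> (nat \<Rightarrow> nat) \<Rightarrow> int \<Rightarrow> 'v set set set" where
  "perm_complex K \<pi> i = {c \<in> derived K. \<forall>\<sigma>\<in>c. simplex_dim \<sigma> \<in> \<pi> ` {j. int j \<le> i}}"

definition perm_space :: "'v set set \<Rightarrow> (nat \<Rightarrow> nat) \<Rightarrow> int \<Rightarrow> ('v \<Rightarrow> real) set" where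
  "perm_space K \<pi> i = derived_space (perm_complex K \<pi> i)"

lemma perm_space_mono: "i \<le> j \<Longrightarrow> perm_space K \<pi> i \<subseteq> perm_space K \<pi> j"
  unfolding perm_space_def derived_space_def
  by (rule image_mono) (fastforce simp: realization_def perm_complex_def)

lemma perm_space_neg:
  assumes "i < 0"
  shows "perm_space K \<pi> i = {}"
proof -
  have "{j. int j \<le> i} = {}"
    using assms by auto
  then have "perm_complex K \<pi> i = {}"
    by (auto simp: perm_complex_def derived_def)
  then show ?thesis
    by (simp add: perm_space_def derived_space_def realization_def)
qed

lemma perm_complex_ge:
  assumes K: "principal_complex n K" and \<pi>: "\<pi> permutes {0..n}" and i: "int n \<le> i"
  shows "perm_complex K \<pi> i = derived K"
proof -
  have "simplex_dim \<sigma> \<in> \<pi> ` {j. int j \<le> i}" if \<sigma>: "\<sigma> \<in> K" for \<sigma>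
  proof -
    obtain \<tau> where \<tau>: "\<tau> \<in> K" "\<sigma> \<subseteq> \<tau>" "simplex_dim \<tau> = n"
      using K \<sigma> by (auto simp: principal_complex_def)
    moreover have "finite \<tau>"
      using K \<tau>(1) by (auto simp: principal_complex_def simplicial_complex_def)
    ultimately have "simplex_dim \<sigma> \<le> n"
      using card_mono[of \<tau> \<sigma>] by (simp add: simplex_dim_def)
    then have "simplex_dim \<sigma> \<in> \<pi> ` {0..n}"
      using permutes_image[OF \<pi>] by simp
    then show ?thesis
      using i by force
  qed
  then show ?thesis
    by (auto simp: perm_complex_def derived_def)
qed

section \<open>Permutation homology\<close>

definition perm_chain_group ::
    "'v set set \<Rightarrow> (nat \<Rightarrow> nat) \<Rightarrow> int \<Rightarrow> ('v \<Rightarrow> real) chain set monoid" where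
  "perm_chain_group K \<pi> i =
     relative_homology_group i (top_of_set (perm_space K \<pi> i)) (perm_space K \<pi> (i - 1))"

definition perm_boundary ::
    "'v set set \<Rightarrow> (nat \<Rightarrow> nat) \<Rightarrow> int \<Rightarrow> ('v \<Rightarrow> real) chain set \<Rightarrow> ('v \<Rightarrow> real) chain set" where
  "perm_boundary K \<pi> i =
     hom_relboundary i (top_of_set (perm_space K \<pi> i))
       (perm_space K \<pi> (i - 1)) (perm_space K \<pi> (i - 2))"

lemma perm_boundary_hom:
  "perm_boundary K \<pi> i \<in> hom (perm_chain_group K \<pi> i) (perm_chain_group K \<pi> (i - 1))"
proof -
  have "perm_space K \<pi> i \<inter> perm_space K \<pi> (i - 1) = perm_space K \<pi> (i - 1)"
    using perm_space_mono[of "i - 1" i K \<pi>] by auto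
  then have "subtopology (top_of_set (perm_space K \<pi> i)) (perm_space K \<pi> (i - 1))
      = top_of_set (perm_space K \<pi> (i - 1))"
    by (simp add: subtopology_subtopology)
  then show ?thesis
    using group_homomorphism_hom_relboundary
      [of i "top_of_set (perm_space K \<pi> i)" "perm_space K \<pi> (i - 1)" "perm_space K \<pi> (i - 2)"]
    by (simp add: perm_boundary_def perm_chain_group_def)
qed

definition perm_cycles ::
    "'v set set \<Rightarrow> (nat \<Rightarrow> nat) \<Rightarrow> int \<Rightarrow> ('v \<Rightarrow> real) chain set set" where
  "perm_cycles K \<pi> i =
     kernel (perm_chain_group K \<pi> i) (perm_chain_group K \<pi> (i - 1)) (perm_boundary K \<pi> i)"

definition perm_boundaries ::
    "'v set set \<Rightarrow> (nat \<Rightarrow> nat) \<Rightarrow> int \<Rightarrow> ('v \<Rightarrow> real) chain set set" where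
  "perm_boundaries K \<pi> i =
     perm_boundary K \<pi> (i + 1) ` carrier (perm_chain_group K \<pi> (i + 1))"

definition perm_homology_group ::
    "'v set set \<Rightarrow> (nat \<Rightarrow> nat) \<Rightarrow> int \<Rightarrow> ('v \<Rightarrow> real) chain set set monoid" where
  "perm_homology_group K \<pi> i =
     (perm_chain_group K \<pi> i)\<lparr>carrier := perm_cycles K \<pi> i\<rparr> Mod perm_boundaries K \<pi> i"

text \<open>
  An element of the permutation homology group is a coset of boundaries.  A homology class \<open>z\<close> of
  \<open>|K\<^sup>\<pi>\<^sub>i|\<close> represents it if the image of \<open>z\<close> in the relative group lies in that coset.  Every coset has
  such a representative, and the class of \<open>z\<close> in \<open>|K|\<close> depends on the coset only, since the
  homology of \<open>|K\<^sup>\<pi>\<^sub>j|\<close> vanishes above degree \<open>j\<close>.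
\<close>

definition natural_map ::
    "'v set set \<Rightarrow> (nat \<Rightarrow> nat) \<Rightarrow> int \<Rightarrow> ('v \<Rightarrow> real) chain set set \<Rightarrow> ('v \<Rightarrow> real) chain set" where
  "natural_map K \<pi> i c =
     (THE y. \<exists>z \<in> carrier (homology_group i (top_of_set (perm_space K \<pi> i))).
        hom_induced i (top_of_set (perm_space K \<pi> i)) {}
          (top_of_set (perm_space K \<pi> i)) (perm_space K \<pi> (i - 1)) id z \<in> c \<and>
        y = hom_induced i (top_of_set (perm_space K \<pi> i)) {} (top_of_set (realization K)) {} id z)"

section \<open>PL maps and PL manifolds\<close>

text \<open>
  These follow the local-cone definitions of Rourke and Sanderson.  Function types have no
  \<open>real_vector\<close> instance, so affine combinations are spelled out.
\<close>

definition affine_comb :: "real \<Rightarrow> ('v \<Rightarrow> real) \<Rightarrow> ('v \<Rightarrow> real) \<Rightarrow> 'v \<Rightarrow> real" where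
  "affine_comb t a x = (\<lambda>v. (1 - t) * a v + t * x v)"

definition cone :: "('v \<Rightarrow> real) \<Rightarrow> ('v \<Rightarrow> real) set \<Rightarrow> ('v \<Rightarrow> real) set" where
  "cone a L = insert a ((\<lambda>(t, x). affine_comb t a x) ` ({0..1} \<times> L))"

text \<open>
  \<open>L\<close> is a link of \<open>a\<close> in \<open>P\<close>: the points of the cone other than \<open>a\<close> lie on a unique segment from \<open>a\<close>
  to \<open>L\<close>, and the cone is a neighbourhood of \<open>a\<close> in \<open>P\<close>.
\<close>

definition is_link :: "('v \<Rightarrow> real) set \<Rightarrow> ('v \<Rightarrow> real) \<Rightarrow> ('v \<Rightarrow> real) set \<Rightarrow> bool" where
  "is_link P a L \<longleftrightarrow>
     compact L \<and> a \<notin> L \<and> inj_on (\<lambda>(t, x). affine_comb t a x) ({0<..1} \<times> L) \<and>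
     cone a L \<subseteq> P \<and> (\<exists>U. openin (top_of_set P) U \<and> a \<in> U \<and> U \<subseteq> cone a L)"

definition PL_map :: "('v \<Rightarrow> real) set \<Rightarrow> (('v \<Rightarrow> real) \<Rightarrow> ('w \<Rightarrow> real)) \<Rightarrow> bool" where
  "PL_map P f \<longleftrightarrow>
     (\<forall>a\<in>P. \<exists>L. is_link P a L \<and>
        (\<forall>x\<in>L. \<forall>t\<in>{0..1}. f (affine_comb t a x) = affine_comb t (f a) (f x)))"

definition PL_homeomorphic :: "('v \<Rightarrow> real) set \<Rightarrow> ('w \<Rightarrow> real) set \<Rightarrow> bool" where
  "PL_homeomorphic P Q \<longleftrightarrow> (\<exists>f g. homeomorphism P Q f g \<and> PL_map P f \<and> PL_map Q g)"

text \<open>For \<open>m = 0\<close> this is a single point.\<close>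

definition half_space :: "nat \<Rightarrow> (nat \<Rightarrow> real) set" where
  "half_space m = {y \<in> topspace (Euclidean_space m). 0 \<le> y 0}"

text \<open>
  PL manifolds may have boundary.  An interior point also has a chart in the half-space, namely one
  with image off the bounding hyperplane.
\<close>

definition PL_manifold :: "('v \<Rightarrow> real) set \<Rightarrow> bool" where
  "PL_manifold P \<longleftrightarrow>
     (\<exists>m. \<forall>x\<in>P. \<exists>U V. openin (top_of_set P) U \<and> x \<in> U \<and>
        openin (top_of_set (half_space m)) V \<and> PL_homeomorphic U V)"

end

theory Submission
  imports Defs
begin

text \<open>
  For a set \<open>S\<close> of dimensions let \<open>X\<^sub>S\<close> be the part of \<open>|K|\<close> spanned by the barycentres of simplexes
  with dimension in \<open>S\<close>; so \<open>|K\<^sup>\<pi>\<^sub>i|\<close> is \<open>X\<^sub>S\<close> with \<open>|S| = i + 1\<close>. The theorem rests on two vanishing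
  results.

  \<^item> \<open>H\<^sub>p(X\<^sub>S) = 0\<close> for \<open>p \<ge> |S|\<close>, because \<open>X\<^sub>S\<close> has dimension \<open>|S| - 1\<close> (\<open>acyclic_perm_space\<close>).
  \<^item> \<open>H\<^sub>p(|K|, X\<^sub>S) = 0\<close> for \<open>p < |S|\<close> (\<open>acyclic_realization_perm_space\<close>).

  The first makes \<open>H\<^sub>i(|K\<^sup>\<pi>\<^sub>i|) \<rightarrow> H\<^sub>i(|K\<^sup>\<pi>\<^sub>i|, |K\<^sup>\<pi>\<^sub>i\<^sub>-\<^sub>1|)\<close> injective. Its image is the group of cycles of the
  permutation chain complex, and the boundaries are the image of the kernel of
  \<open>H\<^sub>i(|K\<^sup>\<pi>\<^sub>i|) \<rightarrow> H\<^sub>i(|K\<^sup>\<pi>\<^sub>i\<^sub>+\<^sub>1|)\<close>. The second makes \<open>H\<^sub>i(|K\<^sup>\<pi>\<^sub>i\<^sub>+\<^sub>1|) \<rightarrow> H\<^sub>i(|K|)\<close> injective and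
  \<open>H\<^sub>i(|K\<^sup>\<pi>\<^sub>i|) \<rightarrow> H\<^sub>i(|K|)\<close> surjective. Hence the natural map is the isomorphism of
  \<open>H\<^sub>i(|K\<^sup>\<pi>\<^sub>i|)\<close> modulo that kernel onto \<open>H\<^sub>i(|K|)\<close> (\<open>natural_map_iso\<close>).

  The second vanishing result is general position in homological form. Up to homotopy \<open>X\<^sub>S\<close> is the
  complement in \<open>|K|\<close> of \<open>X\<^sub>T\<close>, where \<open>T\<close> is the set of the other dimensions, and \<open>X\<^sub>T\<close> has codimension
  \<open>|S|\<close>. The manifold enters through its local homology: \<open>H\<^sub>q(|K|, |K| - x) = 0\<close> for \<open>q < n\<close>, at boundary
  points too (\<open>manifold_locally_acyclic\<close>). Let \<open>V\<^sub>d\<close> be the open set of points whose carrier in the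
  derived complex has a vertex of dimension \<open>d\<close>. A finite intersection \<open>V\<^sub>J\<close> of such sets, with \<open>J\<close> not empty, is a disjoint union of open stars,
  one for each chain of simplexes with set of dimensions \<open>J\<close>, and \<open>X\<^sub>S\<close> is a deformation retract of the union of
  the \<open>V\<^sub>d\<close> with \<open>d \<in> S\<close>. Exact sequences of triples and excision reduce the claim to the pairs
  (open star, open star minus the open simplex at its centre). The homology of such a pair is that of
  (open star, open star minus a point) shifted by the dimension of the simplex, by repeated suspension
  (\<open>acyclic_pair_suspension\<close>). The first vanishing result follows from the same cover, since all open stars are
  contractible.

  All of this takes place in the open cone on a complex, where the coordinates need not add up to 1. There
  a homotopy can move some coordinates without renormalising the others, and passing from a complex to its
  first derived is a homeomorphism given by partial sums of coordinates (\<open>homeomorphism_unfold_chain\<close>).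
\<close>

section \<open>Vanishing of relative homology\<close>

text \<open>
  Until the final diagram chase only the vanishing of relative groups matters, so this is the notion that is
  carried through excision, exact sequences and homotopies.
\<close>

definition acyclic_pair :: "int \<Rightarrow> 'a::topological_space set \<Rightarrow> 'a set \<Rightarrow> bool" where
  "acyclic_pair p X A \<longleftrightarrow> trivial_group (relative_homology_group p (top_of_set X) A)"

lemma acyclic_pair_neg: "p < 0 \<Longrightarrow> acyclic_pair p X A"
  by (simp add: acyclic_pair_def)

lemma acyclic_pair_self: "X \<subseteq> A \<Longrightarrow> acyclic_pair p X A"
  using trivial_relative_homology_group_topspace[of p "top_of_set X"]
    relative_homology_group_restrict[of p "top_of_set X" A]
  by (simp add: acyclic_pair_def Int_absorb2)

lemma acyclic_pair_empty: "acyclic_pair p {} A"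
  by (simp add: acyclic_pair_self)

lemma exact_seq_trivial_middle:
  assumes "exact_seq ([C, B, A], [g, f])" "trivial_group A" "trivial_group C"
  shows "trivial_group B"
proof -
  have f: "group_hom A B f" and g: "group_hom B C g" and ex: "kernel B C g = f ` carrier A"
    using assms(1) by (auto simp: group_hom_def group_hom_axioms_def)
  have "carrier B = kernel B C g"
    using group_hom.kernel_to_trivial_group[OF g assms(3)] by simp
  also have "\<dots> = {\<one>\<^bsub>B\<^esub>}"
    using ex group_hom.image_from_trivial_group[OF f assms(2)] by simp
  finally show ?thesis
    using f by (simp add: trivial_group_def group_hom_def)
qed

lemma subtopology_top_of_set: "A \<subseteq> X \<Longrightarrow> subtopology (top_of_set X) A = top_of_set A"
  by (simp add: subtopology_subtopology Int_absorb1)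

text \<open>
  This and the next two lemmas are the three places of the exact sequence of the triple \<open>A \<subseteq> B \<subseteq> X\<close>.
\<close>

lemma acyclic_pair_trans:
  assumes "A \<subseteq> B" "B \<subseteq> X" "acyclic_pair p B A" "acyclic_pair p X B"
  shows "acyclic_pair p X A"
  using exact_seq_trivial_middle[OF homology_exactness_triple_3[OF assms(1), of p "top_of_set X"]] assms
  by (simp add: acyclic_pair_def subtopology_top_of_set)

lemma acyclic_pair_quotient:
  assumes "A \<subseteq> B" "B \<subseteq> X" "acyclic_pair p X A" "acyclic_pair (p - 1) B A"
  shows "acyclic_pair p X B"
  using exact_seq_trivial_middle[OF homology_exactness_triple_1[OF assms(1), of p "top_of_set X"]] assms
  by (simp add: acyclic_pair_def subtopology_top_of_set)

lemma acyclic_pair_sub: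
  assumes "A \<subseteq> B" "B \<subseteq> X" "acyclic_pair (p + 1) X B" "acyclic_pair p X A"
  shows "acyclic_pair p B A"
  using exact_seq_trivial_middle[OF homology_exactness_triple_2[OF assms(1), of "p + 1" "top_of_set X"]] assms
  by (simp add: acyclic_pair_def subtopology_top_of_set)

text \<open>
  The identity of \<open>(X, A)\<close> is homotopic to a map that factors through \<open>(Y, B)\<close>, so it induces both the
  identity and zero.
\<close>

lemma acyclic_pair_dominated:
  fixes X A :: "'a::topological_space set" and Y B :: "'b::topological_space set"
  assumes Y: "acyclic_pair p Y B" and A: "A \<subseteq> X"
    and f: "continuous_on X f" "f \<in> X \<rightarrow> Y" "f \<in> A \<rightarrow> B"
    and g: "continuous_on Y g" "g \<in> Y \<rightarrow> X" "g \<in> B \<rightarrow> A"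
    and h: "continuous_on ({0..1::real} \<times> X) h" "\<And>t x. t \<in> {0..1} \<Longrightarrow> x \<in> X \<Longrightarrow> h (t, x) \<in> X"
      "\<And>t x. t \<in> {0..1} \<Longrightarrow> x \<in> A \<Longrightarrow> h (t, x) \<in> A"
      "\<And>x. x \<in> X \<Longrightarrow> h (0, x) = x" "\<And>x. x \<in> X \<Longrightarrow> h (1, x) = g (f x)"
  shows "acyclic_pair p X A"
proof -
  let ?X = "top_of_set X" and ?Y = "top_of_set Y"
  have hom: "homotopic_with (\<lambda>k. k \<in> A \<rightarrow> A) ?X ?X id (g \<circ> f)"
  proof -
    have "homotopic_with (\<lambda>k. \<forall>x\<in>A. x \<in> X \<longrightarrow> k x \<in> A) ?X ?X id (g \<circ> f)"
    proof (subst homotopic_with)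
      show "\<exists>h. continuous_map (prod_topology (top_of_set {0..1::real}) ?X) ?X h \<and>
          (\<forall>x\<in>topspace ?X. h (0, x) = id x) \<and> (\<forall>x\<in>topspace ?X. h (1, x) = (g \<circ> f) x) \<and>
          (\<forall>t\<in>{0..1}. \<forall>x\<in>A. x \<in> X \<longrightarrow> h (t, x) \<in> A)"
      proof (rule exI[of _ h], safe)
        show "continuous_map (prod_topology (top_of_set {0..1}) ?X) ?X h"
          using h(1,2) by (auto simp: prod_topology_subtopology_eu)
      qed (use h in auto)
    next
      fix h k :: "'a \<Rightarrow> 'a" assume "\<And>x. x \<in> topspace ?X \<Longrightarrow> h x = k x"
      then show "(\<forall>x\<in>A. x \<in> X \<longrightarrow> h x \<in> A) = (\<forall>x\<in>A. x \<in> X \<longrightarrow> k x \<in> A)"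
        by simp
    qed
    then show ?thesis
      by (rule homotopic_with_mono) (use A in auto)
  qed
  have cf: "continuous_map ?X ?Y f" and cg: "continuous_map ?Y ?X g"
    using f g by auto
  have "hom_induced p ?X A ?X A id = hom_induced p ?X A ?X A (g \<circ> f)"
    by (rule homology_homotopy_axiom[OF hom])
  also have "\<dots> = hom_induced p ?Y B ?X A g \<circ> hom_induced p ?X A ?Y B f"
    by (rule hom_induced_compose[OF cf f(3) cg g(3)])
  finally have eq: "hom_induced p ?X A ?X A id = hom_induced p ?Y B ?X A g \<circ> hom_induced p ?X A ?Y B f" .
  have "c = \<one>\<^bsub>relative_homology_group p ?X A\<^esub>" if c: "c \<in> carrier (relative_homology_group p ?X A)" for c
  proof -
    have "c = hom_induced p ?Y B ?X A g (hom_induced p ?X A ?Y B f c)"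
      using hom_induced_id[OF c] eq by simp
    also have "hom_induced p ?X A ?Y B f c = \<one>\<^bsub>relative_homology_group p ?Y B\<^esub>"
      using Y hom_induced_carrier[of p ?X A ?Y B f c] by (auto simp: acyclic_pair_def trivial_group_def)
    finally show ?thesis
      using hom_one[OF hom_induced_hom[of p ?Y B ?X A g]] by simp
  qed
  then show ?thesis
    by (auto simp: acyclic_pair_def group.trivial_group_subset)
qed

text \<open>
  The deformation pushes \<open>X\<close> into \<open>A\<close> through maps of pairs, so \<open>(X, A)\<close> is dominated by \<open>(A, A)\<close>.
\<close>

lemma acyclic_pair_deformation:
  assumes A: "A \<subseteq> X"
    and h: "continuous_on ({0..1::real} \<times> X) h" "\<And>t x. t \<in> {0..1} \<Longrightarrow> x \<in> X \<Longrightarrow> h (t, x) \<in> X"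
      "\<And>t x. t \<in> {0..1} \<Longrightarrow> x \<in> A \<Longrightarrow> h (t, x) \<in> A"
      "\<And>x. x \<in> X \<Longrightarrow> h (0, x) = x" "\<And>x. x \<in> X \<Longrightarrow> h (1, x) \<in> A"
  shows "acyclic_pair p X A"
proof (rule acyclic_pair_dominated[where f = "\<lambda>x. h (1, x)" and g = id and h = h])
  show "acyclic_pair p A A"
    by (simp add: acyclic_pair_self)
  show "continuous_on X (\<lambda>x. h (1, x))"
    by (rule continuous_on_compose2[OF h(1)]) (auto intro!: continuous_intros)
qed (use assms in auto)

lemma acyclic_pair_homeomorphic:
  assumes Y: "acyclic_pair p Y B" and A: "A \<subseteq> X" and fg: "homeomorphism X Y f g" and B: "f ` A = B"
  shows "acyclic_pair p X A"
proof (rule acyclic_pair_dominated[OF Y A, where f = f and g = g and h = snd])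
  show "g \<in> B \<rightarrow> A"
    using B A fg by (auto simp: homeomorphism_def subset_iff)
  show "continuous_on ({0..1::real} \<times> X) snd"
    by (intro continuous_intros)
qed (use fg A B in \<open>auto simp: homeomorphism_def\<close>)

text \<open>
  Excision of the closed set \<open>U - V\<close>, which lies in the open set \<open>U\<close>.
\<close>

lemma acyclic_pair_excision:
  assumes U: "openin (top_of_set (U \<union> V)) U" and V: "openin (top_of_set (U \<union> V)) V"
  shows "acyclic_pair p (U \<union> V) U \<longleftrightarrow> acyclic_pair p V (U \<inter> V)"
proof -
  let ?X = "top_of_set (U \<union> V)"
  have "hom_induced p (subtopology ?X ((U \<union> V) - (U - V))) (U - (U - V)) (subtopology ?X (U \<union> V)) U id
    \<in> iso (relative_homology_group p (subtopology ?X ((U \<union> V) - (U - V))) (U - (U - V)))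
          (relative_homology_group p (subtopology ?X (U \<union> V)) U)"
  proof (rule homology_excision_axiom)
    have "closedin ?X (U \<union> V - V)"
      using V by (simp add: closedin_diff)
    moreover have "U \<union> V - V = U - V" by auto
    ultimately have "?X closure_of (U - V) = U - V"
      by (simp add: closure_of_closedin)
    moreover have "?X interior_of U = U"
      using U by (simp add: interior_of_openin)
    ultimately show "?X closure_of (U - V) \<subseteq> ?X interior_of U"
      by auto
  qed auto
  moreover have "(U \<union> V) - (U - V) = V" "U - (U - V) = U \<inter> V" "(U \<union> V) \<inter> V = V"
    by auto
  ultimately have "relative_homology_group p (top_of_set V) (U \<inter> V) \<cong> relative_homology_group p ?X U"
    by (auto simp: is_iso_def subtopology_subtopology)
  then show ?thesis
    unfolding acyclic_pair_def by (simp add: isomorphic_group_triviality)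
qed

text \<open>
  The part of the Mayer--Vietoris sequence that bounds the dimension of a union.
\<close>

lemma acyclic_union:
  assumes U: "openin (top_of_set (U \<union> V)) U" and V: "openin (top_of_set (U \<union> V)) V"
    and "acyclic_pair p U {}" "acyclic_pair p V {}" "acyclic_pair (p - 1) (U \<inter> V) {}"
  shows "acyclic_pair p (U \<union> V) {}"
proof (rule acyclic_pair_trans[where B = U])
  have "acyclic_pair p V (U \<inter> V)"
    by (rule acyclic_pair_quotient[where A = "{}"]) (use assms in auto)
  then show "acyclic_pair p (U \<union> V) U"
    by (simp add: acyclic_pair_excision[OF U V])
qed (use assms in auto)

text \<open>
  A relative cycle and its boundary involve finitely many singular simplexes, whose images lie in a
  compact set. A bounding chain found inside \<open>X'\<close> is also one in \<open>X\<close>.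
\<close>

lemma acyclic_pair_compactly_supported:
  assumes A: "A \<subseteq> X"
    and fin: "\<And>C. compactin (top_of_set X) C \<Longrightarrow> \<exists>X'. C \<subseteq> X' \<and> X' \<subseteq> X \<and> acyclic_pair p X' (A \<inter> X')"
  shows "acyclic_pair p X A"
proof (cases "p < 0")
  case True
  then show ?thesis by (simp add: acyclic_pair_neg)
next
  case False
  then obtain n where p: "p = int n"
    by (metis int_nat_eq not_less)
  have "homologous_rel_set n (top_of_set X) A c = \<one>\<^bsub>relative_homology_group p (top_of_set X) A\<^esub>"
    if c: "singular_relcycle n (top_of_set X) A c" for c
  proof -
    have ch: "singular_chain n (top_of_set X) c"
      and bd: "singular_chain (n - 1) (subtopology (top_of_set X) A) (chain_boundary n c)"
      using c by (simp_all add: singular_relcycle)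
    have comp: "compactin (top_of_set X) (f ` standard_simplex n)" if f: "f \<in> Poly_Mapping.keys c" for f
    proof -
      have "continuous_map (subtopology (powertop_real UNIV) (standard_simplex n)) (top_of_set X) f"
        using ch f by (auto simp: singular_chain_def singular_simplex_def)
      moreover have "compactin (subtopology (powertop_real UNIV) (standard_simplex n)) (standard_simplex n)"
        by (simp add: compactin_subtopology compactin_standard_simplex)
      ultimately show ?thesis
        using image_compactin by blast
    qed
    have "compactin (top_of_set X) (\<Union>f\<in>Poly_Mapping.keys c. f ` standard_simplex n)"
      by (rule compactin_Union) (use comp in \<open>blast intro: finite_keys\<close>)+
    from fin[OF this] obtain X' where X': "(\<Union>f\<in>Poly_Mapping.keys c. f ` standard_simplex n) \<subseteq> X'" "X' \<subseteq> X"
      and van: "acyclic_pair p X' (A \<inter> X')"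
      by (elim exE conjE)
    have ch': "singular_chain n (top_of_set X') c"
      using ch X' singular_chain_subtopology[of n "top_of_set X" X' c]
      by (auto simp: subtopology_top_of_set)
    have "singular_chain (n - 1) (top_of_set X') (chain_boundary n c)"
      using singular_chain_boundary[OF ch'] by simp
    moreover have "subtopology (top_of_set X') (A \<inter> X') = subtopology (top_of_set X') A"
      by (simp add: subtopology_subtopology inf_commute inf_left_commute)
    ultimately have "singular_chain (n - 1) (subtopology (top_of_set X') (A \<inter> X')) (chain_boundary n c)"
      using bd by (auto simp: singular_chain_subtopology)
    then have rc: "singular_relcycle n (top_of_set X') (A \<inter> X') c"
      using ch' by (simp add: singular_relcycle)
    then have "homologous_rel_set n (top_of_set X') (A \<inter> X') c
        \<in> carrier (relative_homology_group p (top_of_set X') (A \<inter> X'))"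
      unfolding p carrier_relative_homology_group by blast
    then have "homologous_rel_set n (top_of_set X') (A \<inter> X') c
        = singular_relboundary_set n (top_of_set X') (A \<inter> X')"
      using van by (auto simp: acyclic_pair_def trivial_group_def p)
    then have "singular_relboundary n (top_of_set X') (A \<inter> X') c"
      by (simp add: homologous_rel_set_eq_relboundary)
    then obtain d e where d: "singular_chain (Suc n) (top_of_set X') d"
      and e: "singular_chain n (subtopology (top_of_set X') (A \<inter> X')) e"
      and eq: "chain_boundary (Suc n) d + e = c"
      by (auto simp: singular_relboundary)
    have "singular_chain (Suc n) (top_of_set X) d"
      using d X' singular_chain_mono[of _ euclidean X' d X] by simp
    moreover have "singular_chain n (subtopology (top_of_set X) A) e"
      using e A X' singular_chain_mono[of _ euclidean "A \<inter> X'" e A]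
      by (simp add: subtopology_subtopology Int_absorb1 inf_assoc Int_absorb2 le_infI2 inf_left_commute)
    ultimately have "singular_relboundary n (top_of_set X) A c"
      using eq by (auto simp: singular_relboundary)
    then show ?thesis
      by (simp add: p homologous_rel_set_eq_relboundary)
  qed
  then show ?thesis
    by (auto simp: acyclic_pair_def group.trivial_group_subset p carrier_relative_homology_group)
qed

text \<open>
  Additivity for pairs. Finite unions are handled by excision, one member at a time; a compact set meets
  finitely many members of a disjoint open cover.
\<close>

lemma acyclic_pair_disjoint_union:
  assumes opn: "\<And>i. i \<in> I \<Longrightarrow> openin (top_of_set (\<Union>i\<in>I. U i)) (U i)"
    and A: "openin (top_of_set (\<Union>i\<in>I. U i)) A"
    and disj: "\<And>i j. i \<in> I \<Longrightarrow> j \<in> I \<Longrightarrow> i \<noteq> j \<Longrightarrow> U i \<inter> U j = {}"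
    and van: "\<And>i. i \<in> I \<Longrightarrow> acyclic_pair p (U i) (A \<inter> U i)"
  shows "acyclic_pair p (\<Union>i\<in>I. U i) A"
proof (rule acyclic_pair_compactly_supported)
  let ?X = "\<Union>i\<in>I. U i"
  have sub: "openin (top_of_set Y) S" if "openin (top_of_set ?X) S" "S \<subseteq> Y" "Y \<subseteq> ?X" for S Y
    using that openin_subset_trans by blast
  have fin: "acyclic_pair p (\<Union>i\<in>F. U i) (A \<inter> (\<Union>i\<in>F. U i))" if "finite F" "F \<subseteq> I" for F
    using that
  proof (induction F)
    case empty
    then show ?case by (simp add: acyclic_pair_empty)
  next
    case (insert i F)
    let ?Y = "\<Union>i\<in>F. U i"
    have Ui: "openin (top_of_set ?X) (U i)" and Y: "openin (top_of_set ?X) ?Y"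
      using insert opn by (auto intro: openin_Union)
    have Yi: "?Y \<inter> U i = {}"
      using insert disj by fastforce
    have le: "U i \<union> ?Y \<subseteq> ?X"
      using insert by auto
    have opAY: "openin (top_of_set ?X) (A \<inter> ?Y)" "openin (top_of_set ?X) (A \<inter> U i)"
      using A Ui Y by (auto intro: openin_Int)
    have "acyclic_pair p ((U i \<union> (A \<inter> ?Y)) \<union> ?Y) (U i \<union> (A \<inter> ?Y))
        = acyclic_pair p ?Y ((U i \<union> (A \<inter> ?Y)) \<inter> ?Y)"
      by (rule acyclic_pair_excision; rule sub) (use le Ui Y opAY in \<open>auto intro: openin_Un\<close>)
    moreover have "(U i \<union> (A \<inter> ?Y)) \<inter> ?Y = A \<inter> ?Y" "(U i \<union> (A \<inter> ?Y)) \<union> ?Y = U i \<union> ?Y"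
      using Yi by auto
    ultimately have 1: "acyclic_pair p (U i \<union> ?Y) (U i \<union> (A \<inter> ?Y))"
      using insert by simp
    have "acyclic_pair p ((A \<inter> (U i \<union> ?Y)) \<union> U i) (A \<inter> (U i \<union> ?Y))
        = acyclic_pair p (U i) ((A \<inter> (U i \<union> ?Y)) \<inter> U i)"
      by (rule acyclic_pair_excision; rule sub)
        (use le Ui opAY in \<open>auto simp: Int_Un_distrib simp del: UN_simps Int_UN_distrib intro: openin_Un\<close>)
    moreover have "(A \<inter> (U i \<union> ?Y)) \<inter> U i = A \<inter> U i" "(A \<inter> (U i \<union> ?Y)) \<union> U i = U i \<union> (A \<inter> ?Y)"
      using Yi by auto
    ultimately have 2: "acyclic_pair p (U i \<union> (A \<inter> ?Y)) (A \<inter> (U i \<union> ?Y))"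
      using insert van by simp
    have "acyclic_pair p (U i \<union> ?Y) (A \<inter> (U i \<union> ?Y))"
      by (rule acyclic_pair_trans[OF _ _ 2 1]) auto
    then show ?case by simp
  qed
  show "A \<subseteq> ?X"
    using A openin_subset by fastforce
  fix C assume C: "compactin (top_of_set ?X) C"
  then have "\<exists>\<F>. finite \<F> \<and> \<F> \<subseteq> U ` I \<and> C \<subseteq> \<Union>\<F>"
    unfolding compactin_def using opn by (metis (no_types, lifting) image_iff topspace_euclidean_subtopology)
  then obtain F where "finite F" "F \<subseteq> I" "C \<subseteq> (\<Union>i\<in>F. U i)"
    by (metis finite_subset_image)
  then show "\<exists>X'. C \<subseteq> X' \<and> X' \<subseteq> ?X \<and> acyclic_pair p X' (A \<inter> X')"
    using fin by (intro exI[of _ "\<Union>i\<in>F. U i"]) auto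
qed

text \<open>
  The analogue for homology of the fact that the nerve of a cover by \<open>m\<close> sets has dimension at most
  \<open>m - 1\<close>. Induction on the number of sets applies to the union of all but one of them and to its
  intersection with the last one.
\<close>

lemma acyclic_finite_open_cover:
  assumes "finite I" and opn: "\<And>i. i \<in> I \<Longrightarrow> openin (top_of_set X) (U i)"
    and van: "\<And>J p. J \<subseteq> I \<Longrightarrow> J \<noteq> {} \<Longrightarrow> p > 0 \<Longrightarrow> acyclic_pair p (\<Inter>i\<in>J. U i) {}"
    and "p \<ge> int (card I)"
  shows "acyclic_pair p (\<Union>i\<in>I. U i) {}"
  using assms
proof (induction I arbitrary: U p)
  case empty
  then show ?case by (simp add: acyclic_pair_empty)
next
  case (insert m I)
  let ?Y = "\<Union>i\<in>I. U i"
  have card: "int (card I) \<le> p - 1" "p > 0"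
    using insert.hyps insert.prems(3) by auto
  have 1: "acyclic_pair p ?Y {}"
  proof (rule insert.IH)
    show "acyclic_pair q (\<Inter>i\<in>J. U i) {}" if "J \<subseteq> I" "J \<noteq> {}" "q > 0" for J q
      by (rule insert.prems(2)) (use that in auto)
  qed (use insert.prems(1) card in auto)
  have 2: "acyclic_pair p (U m) {}"
    using insert.prems(2)[of "{m}" p] card by simp
  have 3: "acyclic_pair (p - 1) (\<Union>i\<in>I. U i \<inter> U m) {}"
  proof (rule insert.IH)
    show "openin (top_of_set X) (U i \<inter> U m)" if "i \<in> I" for i
      using that insert.prems(1) by (auto intro: openin_Int)
    show "acyclic_pair q (\<Inter>i\<in>J. U i \<inter> U m) {}" if "J \<subseteq> I" "J \<noteq> {}" "q > 0" for J q
    proof -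
      have "(\<Inter>i\<in>J. U i \<inter> U m) = (\<Inter>i\<in>insert m J. U i)"
        using that by auto
      then show ?thesis
        using insert.prems(2)[of "insert m J" q] that by auto
    qed
  qed (use card in auto)
  have op: "openin (top_of_set X) ?Y" "openin (top_of_set X) (U m)" "?Y \<union> U m \<subseteq> X"
    using insert.prems(1) openin_subset by (fastforce intro: openin_Union)+
  have "acyclic_pair p (?Y \<union> U m) {}"
  proof (rule acyclic_union)
    show "acyclic_pair (p - 1) (?Y \<inter> U m) {}"
      using 3 by (simp only: Int_UN_distrib2 UN_extend_simps)
    show "openin (top_of_set (?Y \<union> U m)) ?Y"
      by (rule openin_subset_trans[OF op(1)]) (use op in auto)
    show "openin (top_of_set (?Y \<union> U m)) (U m)"
      by (rule openin_subset_trans[OF op(2)]) (use op in auto)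
  qed (use 1 2 in auto)
  then show ?case
    by (simp add: Un_commute)
qed

text \<open>
  The suspension isomorphism \<open>H\<^sub>p\<^sub>+\<^sub>1(Z, Z - (P \<inter> {g = 0})) = H\<^sub>p(Z, Z - P)\<close>, for a space \<open>Z\<close> in which one can move
  up and down along \<open>g\<close> without entering or leaving \<open>P\<close>. The model is \<open>Z = Y \<times> \<real>\<close> and \<open>P = A \<times> \<real>\<close>, with \<open>g\<close>
  the projection to \<open>\<real>\<close>. Moving up shows that the intermediate complement of \<open>P \<inter> {g \<le> 0}\<close> has the homology
  of \<open>Z\<close>; what remains is the pair over \<open>{g < 0}\<close>, and moving down compares that region with all of \<open>Z\<close>.
\<close>

lemma acyclic_pair_suspension:
  fixes g :: "'a::topological_space \<Rightarrow> real"
  assumes P: "closedin (top_of_set Z) P" and g: "continuous_on Z g"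
    and h: "continuous_on ({0..1::real} \<times> Z) h" "\<And>z. z \<in> Z \<Longrightarrow> h (0, z) = z"
      "\<And>t z. t \<in> {0..1} \<Longrightarrow> z \<in> Z \<Longrightarrow> h (t, z) \<in> Z \<and> (h (t, z) \<in> P \<longleftrightarrow> z \<in> P) \<and> g z \<le> g (h (t, z))"
      "\<And>z. z \<in> Z \<Longrightarrow> 0 < g (h (1, z))"
    and k: "continuous_on ({0..1::real} \<times> Z) k" "\<And>z. z \<in> Z \<Longrightarrow> k (0, z) = z"
      "\<And>t z. t \<in> {0..1} \<Longrightarrow> z \<in> Z \<Longrightarrow> k (t, z) \<in> Z \<and> (k (t, z) \<in> P \<longleftrightarrow> z \<in> P) \<and> g (k (t, z)) \<le> g z"
      "\<And>z. z \<in> Z \<Longrightarrow> g (k (1, z)) < 0"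
  shows "acyclic_pair (p + 1) Z (Z - {z \<in> P. g z = 0}) \<longleftrightarrow> acyclic_pair p Z (Z - P)"
proof -
  \<comment> \<open>the triple \<open>W' \<subseteq> W \<subseteq> Z\<close>; \<open>W\<close> and \<open>W'\<close> differ only over \<open>{g < 0}\<close>\<close>
  define W where "W = Z - {z \<in> P. g z = 0}"
  define W' where "W' = Z - {z \<in> P. g z \<le> 0}"
  define G where "G = {z \<in> Z. g z < 0}"
  have PZ: "P \<subseteq> Z"
    using P closedin_subset by fastforce
  have 1: "acyclic_pair q Z W'" for q
  proof (rule acyclic_pair_deformation[OF _ h(1)])
    show "h (t, z) \<in> W'" if "t \<in> {0..1}" "z \<in> W'" for t z
      using h(3)[of t z] that unfolding W'_def by fastforce
    show "h (1, z) \<in> W'" if "z \<in> Z" for z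
      using h(3)[of 1 z] h(4)[of z] that unfolding W'_def by auto
  qed (use h in \<open>auto simp: W'_def\<close>)
  have "closedin (top_of_set Z) {z \<in> Z. g z \<le> 0}"
    using continuous_closedin_preimage[OF g closed_atMost[of 0]] by (simp add: vimage_def Int_def)
  then have "closedin (top_of_set Z) (P \<inter> {z \<in> Z. g z \<le> 0})"
    using P by blast
  moreover have "Z - (P \<inter> {z \<in> Z. g z \<le> 0}) = W'"
    using PZ by (auto simp: W'_def)
  ultimately have opW': "openin (top_of_set Z) W'"
    by (metis openin_diff openin_topspace topspace_euclidean_subtopology)
  have opG: "openin (top_of_set Z) G"
    using continuous_openin_preimage_gen[OF g open_lessThan[of 0]] by (simp add: G_def vimage_def Int_def)
  have WG: "W' \<union> G = W" "W' \<inter> G = G - P" "W \<subseteq> Z" "W' \<subseteq> W"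
    by (auto simp: W_def W'_def G_def)
  have "acyclic_pair p (W' \<union> G) W' \<longleftrightarrow> acyclic_pair p G (W' \<inter> G)"
    by (rule acyclic_pair_excision; rule openin_subset_trans) (use opW' opG WG in auto)
  then have 2: "acyclic_pair p W W' \<longleftrightarrow> acyclic_pair p G (G - P)"
    by (simp add: WG)
  have 3: "acyclic_pair (p + 1) Z W \<longleftrightarrow> acyclic_pair p W W'"
    using acyclic_pair_sub[OF WG(4,3)] acyclic_pair_quotient[OF WG(4,3), of "p + 1"] 1 by auto
  have k1: "continuous_on Z (\<lambda>z. k (1, z))"
    by (rule continuous_on_compose2[OF k(1)]) (auto intro!: continuous_intros)
  have 4: "acyclic_pair p G (G - P)" if "acyclic_pair p Z (Z - P)"
  proof (rule acyclic_pair_dominated[OF that, where f = id and g = "\<lambda>z. k (1, z)" and h = k])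
    show "continuous_on ({0..1} \<times> G) k"
      by (rule continuous_on_subset[OF k(1)]) (auto simp: G_def)
    show "k (t, z) \<in> G" if "t \<in> {0..1}" "z \<in> G" for t z
      using k(3)[of t z] that by (auto simp: G_def)
    show "k (t, z) \<in> G - P" if "t \<in> {0..1}" "z \<in> G - P" for t z
      using k(3)[of t z] that by (auto simp: G_def)
    show "(\<lambda>z. k (1, z)) \<in> Z - P \<rightarrow> G - P"
      using k(3)[of 1] k(4) by (auto simp: G_def)
  qed (use k k1 in \<open>auto simp: G_def\<close>)
  have 5: "acyclic_pair p Z (Z - P)" if "acyclic_pair p G (G - P)"
  proof (rule acyclic_pair_dominated[OF that, where f = "\<lambda>z. k (1, z)" and g = id and h = k])
    show "(\<lambda>z. k (1, z)) \<in> Z - P \<rightarrow> G - P"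
      using k(3)[of 1] k(4) by (auto simp: G_def)
    show "(\<lambda>z. k (1, z)) \<in> Z \<rightarrow> G"
      using k(3)[of 1] k(4) by (auto simp: G_def)
    show "k (t, z) \<in> Z - P" if "t \<in> {0..1}" "z \<in> Z - P" for t z
      using k(3)[of t z] that by (auto simp: G_def)
  qed (use k k1 in \<open>auto simp: G_def\<close>)
  show ?thesis
    using 2 3 4 5 by (auto simp: W_def)
qed

section \<open>Cones over coloured complexes\<close>

text \<open>
  The open cone on the realization, without its apex: coordinates are not required to add up to 1.
\<close>

definition cone_space :: "'w set set \<Rightarrow> ('w \<Rightarrow> real) set" where
  "cone_space D = {u. (\<forall>w. 0 \<le> u w) \<and> supp u \<in> D}"

lemma in_supp_cone: "u \<in> cone_space D \<Longrightarrow> w \<in> supp u \<longleftrightarrow> 0 < u w"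
  by (auto simp: cone_space_def supp_def order_less_le)

lemma openin_coordinate_pos:
  fixes X :: "('w \<Rightarrow> real) set"
  shows "openin (top_of_set X) {u \<in> X. 0 < u w}"
proof -
  have "open {u :: 'w \<Rightarrow> real. 0 < u w}"
    by (intro open_Collect_less continuous_intros continuous_on_product_coordinates)
  from openin_open_Int[OF this, of X] show ?thesis
    by (simp add: Int_def)
qed

definition star :: "'w set set \<Rightarrow> 'w set \<Rightarrow> ('w \<Rightarrow> real) set" where
  "star D \<sigma> = {u \<in> cone_space D. \<sigma> \<subseteq> supp u}"

text \<open>
  As \<open>\<tau>\<close> grows from a single vertex to all of \<open>\<sigma>\<close>, these sets descend from the open cone over the simplex
  \<open>\<sigma>\<close> to the ray through its barycentre, and each step imposes one equation.
\<close>

definition equal_on :: "'w set set \<Rightarrow> 'w set \<Rightarrow> 'w set \<Rightarrow> ('w \<Rightarrow> real) set" where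
  "equal_on D \<sigma> \<tau> = {u \<in> cone_space D. supp u = \<sigma> \<and> (\<forall>w\<in>\<tau>. \<forall>w'\<in>\<tau>. u w = u w')}"

abbreviation ray :: "'w set set \<Rightarrow> 'w set \<Rightarrow> ('w \<Rightarrow> real) set" where
  "ray D \<sigma> \<equiv> equal_on D \<sigma> \<sigma>"

lemma openin_star:
  assumes "finite \<sigma>"
  shows "openin (top_of_set (cone_space D)) (star D \<sigma>)"
proof -
  have "star D \<sigma> = cone_space D \<inter> (\<Inter>w\<in>\<sigma>. {u \<in> cone_space D. 0 < u w})"
    using in_supp_cone[of _ D] by (auto simp: star_def)
  moreover have "openin (top_of_set (cone_space D)) (cone_space D \<inter> (\<Inter>w\<in>\<sigma>. {u \<in> cone_space D. 0 < u w}))"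
  proof (cases "\<sigma> = {}")
    case False
    then show ?thesis
      using assms by (intro openin_Int openin_INT2) (auto intro: openin_coordinate_pos)
  qed auto
  ultimately show ?thesis by simp
qed

text \<open>
  The star contracts linearly to the point whose coordinates are 1 on \<open>\<sigma>\<close> and 0 elsewhere.
\<close>

lemma acyclic_star:
  assumes \<sigma>: "\<sigma> \<in> D" and p: "p > 0"
  shows "acyclic_pair p (star D \<sigma>) {}"
proof -
  let ?b = "\<lambda>w. if w \<in> \<sigma> then 1 else 0 :: real"
  have supp_b: "supp ?b = \<sigma>"
    by (auto simp: supp_def)
  then have b: "?b \<in> star D \<sigma>"
    using \<sigma> by (simp add: star_def cone_space_def)
  show ?thesis
  proof (rule acyclic_pair_dominated[where Y = "{?b}" and B = "{}" and f = "\<lambda>_. ?b" and g = id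
        and h = "\<lambda>(t, u). affine_comb t u ?b"])
    show "acyclic_pair p {?b} {}"
      unfolding acyclic_pair_def by (rule homology_dimension_axiom[where a = ?b]) (use p in auto)
    show "continuous_on ({0..1} \<times> star D \<sigma>) (\<lambda>(t, u). affine_comb t u ?b)"
      unfolding affine_comb_def case_prod_beta
      by (intro continuous_on_coordinatewise_then_product continuous_intros
          continuous_on_product_then_coordinatewise[OF continuous_on_snd] continuous_on_id)
    show "(\<lambda>(t, u). affine_comb t u ?b) (t, u) \<in> star D \<sigma>" if t: "t \<in> {0..1}" and u: "u \<in> star D \<sigma>" for t u
    proof (cases "t = 1")
      case True
      then show ?thesis
        using b by (simp add: affine_comb_def)
    next
      case False
      have nn: "0 \<le> u w" for w
        using u by (auto simp: star_def cone_space_def)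
      have "supp (affine_comb t u ?b) = supp u"
      proof -
        have "affine_comb t u ?b w \<noteq> 0 \<longleftrightarrow> u w \<noteq> 0" for w
        proof (cases "w \<in> \<sigma>")
          case True
          then have "u w > 0"
            using u nn[of w] by (auto simp: star_def supp_def order_less_le)
          then have "(1 - t) * u w + t > 0"
            using t False by (intro add_pos_nonneg mult_pos_pos) auto
          then show ?thesis
            using True \<open>u w > 0\<close> by (simp add: affine_comb_def)
        qed (use False in \<open>simp add: affine_comb_def\<close>)
        then show ?thesis by (simp add: supp_def)
      qed
      then show ?thesis
        using u t nn by (auto simp: star_def cone_space_def affine_comb_def)
    qed
  qed (use b in \<open>auto simp: affine_comb_def\<close>)
qed

lemma closedin_equal_on_star:
  assumes "\<tau> \<subseteq> \<sigma>"
  shows "closedin (top_of_set (star D \<sigma>)) (equal_on D \<sigma> \<tau>)"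
proof -
  have cl: "closed {u :: 'a \<Rightarrow> real. (\<forall>w. w \<notin> \<sigma> \<longrightarrow> u w = 0) \<and> (\<forall>w. \<forall>w'. w \<in> \<tau> \<and> w' \<in> \<tau> \<longrightarrow> u w = u w')}"
    by (intro closed_Collect_conj closed_Collect_all closed_Collect_imp open_Collect_const
        closed_Collect_eq continuous_on_const continuous_on_product_coordinates)
  have "equal_on D \<sigma> \<tau> = star D \<sigma> \<inter> {u. (\<forall>w. w \<notin> \<sigma> \<longrightarrow> u w = 0) \<and> (\<forall>w. \<forall>w'. w \<in> \<tau> \<and> w' \<in> \<tau> \<longrightarrow> u w = u w')}"
    by (auto simp: equal_on_def star_def supp_def)
  then show ?thesis
    using closedin_closed_Int[OF cl, of "star D \<sigma>"] by simp
qed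

text \<open>
  In the whole cone, unlike in the star, a point that vanishes off \<open>\<sigma>\<close> and is constant on \<open>\<sigma>\<close> might have
  smaller support; this would make it the apex, which is not in the cone.
\<close>

lemma closedin_ray:
  assumes "simplicial_complex D"
  shows "closedin (top_of_set (cone_space D)) (ray D \<sigma>)"
proof -
  have cl: "closed {u :: 'a \<Rightarrow> real. (\<forall>w. w \<notin> \<sigma> \<longrightarrow> u w = 0) \<and> (\<forall>w. \<forall>w'. w \<in> \<sigma> \<and> w' \<in> \<sigma> \<longrightarrow> u w = u w')}"
    by (intro closed_Collect_conj closed_Collect_all closed_Collect_imp open_Collect_const
        closed_Collect_eq continuous_on_const continuous_on_product_coordinates)
  have supp_zero: "u w = 0" if "w \<notin> supp u" for u :: "'a \<Rightarrow> real" and w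
    using that by (simp add: supp_def)
  have "supp u = \<sigma>" if "u \<in> cone_space D" "\<forall>w. w \<notin> \<sigma> \<longrightarrow> u w = 0" "\<forall>w\<in>\<sigma>. \<forall>w'\<in>\<sigma>. u w = u w'" for u
  proof -
    have "supp u \<noteq> {}"
      using that(1) assms by (auto simp: cone_space_def simplicial_complex_def)
    then obtain w where w: "u w \<noteq> 0"
      by (auto simp: supp_def)
    then have "w \<in> \<sigma>"
      using that(2) by auto
    then have "u w' \<noteq> 0" if "w' \<in> \<sigma>" for w'
      using that \<open>\<forall>w\<in>\<sigma>. \<forall>w'\<in>\<sigma>. u w = u w'\<close> w by metis
    then show ?thesis
      using that(2) by (auto simp: supp_def)
  qed
  then have "u \<in> ray D \<sigma> \<longleftrightarrow> u \<in> cone_space D \<and> (\<forall>w. w \<notin> \<sigma> \<longrightarrow> u w = 0) \<and> (\<forall>w. \<forall>w'. w \<in> \<sigma> \<and> w' \<in> \<sigma> \<longrightarrow> u w = u w')" for u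
    using supp_zero[of _ u] unfolding equal_on_def mem_Collect_eq by metis
  then have "ray D \<sigma> = cone_space D \<inter> {u. (\<forall>w. w \<notin> \<sigma> \<longrightarrow> u w = 0) \<and> (\<forall>w. \<forall>w'. w \<in> \<sigma> \<and> w' \<in> \<sigma> \<longrightarrow> u w = u w')}"
    by blast
  then show ?thesis
    using closedin_closed_Int[OF cl, of "cone_space D"] by simp
qed

text \<open>
  Suspension along \<open>u w - u w0\<close>. Only the coordinate at \<open>w\<close> moves, and it stays positive, so neither the
  support nor the equations on \<open>\<tau>\<close> are affected.
\<close>

lemma star_suspension_step:
  assumes \<tau>: "\<tau> \<subseteq> \<sigma>" "w0 \<in> \<tau>" and w: "w \<in> \<sigma>" "w \<notin> \<tau>"
  shows "acyclic_pair (p + 1) (star D \<sigma>) (star D \<sigma> - equal_on D \<sigma> (insert w \<tau>))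
    \<longleftrightarrow> acyclic_pair p (star D \<sigma>) (star D \<sigma> - equal_on D \<sigma> \<tau>)"
proof -
  let ?Z = "star D \<sigma>" and ?P = "equal_on D \<sigma> \<tau>"
  define h where "h = (\<lambda>(t :: real, u :: 'a \<Rightarrow> real) v. if v = w then u w + t * u w0 else u v)"
  \<comment> \<open>at \<open>t = 1\<close> the new coordinate is half the harmonic mean of \<open>u w\<close> and \<open>u w0\<close>, so it is below both\<close>
  define k where "k = (\<lambda>(t :: real, u :: 'a \<Rightarrow> real) v. if v = w then u w * u w0 / (u w0 + t * u w) else u v)"
  have pos: "u w > 0" "u w0 > 0" if "u \<in> ?Z" for u
    using that w \<tau> in_supp_cone[of u D] by (auto simp: star_def)
  have modify: "u' \<in> ?Z \<and> (u' \<in> ?P \<longleftrightarrow> u \<in> ?P)"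
    if u: "u \<in> ?Z" and u': "\<And>v. v \<noteq> w \<Longrightarrow> u' v = u v" "u' w > 0" for u u'
  proof -
    have "supp u' = supp u"
    proof -
      have "u' v \<noteq> 0 \<longleftrightarrow> u v \<noteq> 0" for v
        using u' pos[OF u] by (cases "v = w") auto
      then show ?thesis by (simp add: supp_def)
    qed
    moreover have "0 \<le> u' v" for v
      using u' u by (cases "v = w") (auto simp: star_def cone_space_def)
    moreover have "u' v = u v" if "v \<in> \<tau>" for v
      by (rule u'(1)) (use that w in auto)
    ultimately show ?thesis
      using u by (auto simp: star_def cone_space_def equal_on_def)
  qed
  have kden: "u w0 + t * u w > 0" if "u \<in> ?Z" "t \<in> {0..1}" for u t
    using pos[OF that(1)] that(2) by (simp add: add_pos_nonneg)
  have coord: "continuous_on ({0..1::real} \<times> ?Z) (\<lambda>x. snd x v)" for v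
    by (intro continuous_on_product_then_coordinatewise[OF continuous_on_snd] continuous_on_id)
  have conth: "continuous_on ({0..1} \<times> ?Z) h"
    unfolding h_def case_prod_beta
  proof (rule continuous_on_coordinatewise_then_product)
    show "continuous_on ({0..1} \<times> ?Z) (\<lambda>x. if v = w then snd x w + fst x * snd x w0 else snd x v)" for v
      using coord by (cases "v = w") (auto intro!: continuous_intros)
  qed
  have contk: "continuous_on ({0..1} \<times> ?Z) k"
    unfolding k_def case_prod_beta
  proof (rule continuous_on_coordinatewise_then_product)
    show "continuous_on ({0..1} \<times> ?Z) (\<lambda>x. if v = w then snd x w * snd x w0 / (snd x w0 + fst x * snd x w) else snd x v)" for v
    proof (cases "v = w")
      case True
      have "snd x w0 + fst x * snd x w \<noteq> 0" if "x \<in> {0..1} \<times> ?Z" for x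
        using kden[of "snd x" "fst x"] that by auto
      then show ?thesis
        using True coord by (auto intro!: continuous_intros)
    qed (use coord in simp)
  qed
  have "acyclic_pair (p + 1) ?Z (?Z - {z \<in> ?P. z w - z w0 = 0}) \<longleftrightarrow> acyclic_pair p ?Z (?Z - ?P)"
  proof (rule acyclic_pair_suspension[where h = h and k = k])
    show "closedin (top_of_set ?Z) ?P"
      by (rule closedin_equal_on_star[OF \<tau>(1)])
    show "continuous_on ?Z (\<lambda>z. z w - z w0)"
      by (intro continuous_intros continuous_on_subset[OF continuous_on_product_coordinates subset_UNIV])
    show "h (t, z) \<in> ?Z \<and> (h (t, z) \<in> ?P \<longleftrightarrow> z \<in> ?P) \<and> z w - z w0 \<le> h (t, z) w - h (t, z) w0"
      if "t \<in> {0..1}" "z \<in> ?Z" for t z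
    proof -
      have "h (t, z) w > 0" "h (t, z) w \<ge> z w"
        using pos[OF that(2)] that(1) by (auto simp: h_def add_pos_nonneg)
      moreover have "h (t, z) w0 = z w0"
        using w \<tau> by (auto simp: h_def)
      ultimately show ?thesis
        using modify[OF that(2), of "h (t, z)"] by (auto simp: h_def)
    qed
    show "0 < h (1, z) w - h (1, z) w0" if "z \<in> ?Z" for z
      using pos[OF that] w \<tau> by (auto simp: h_def)
    show "k (t, z) \<in> ?Z \<and> (k (t, z) \<in> ?P \<longleftrightarrow> z \<in> ?P) \<and> k (t, z) w - k (t, z) w0 \<le> z w - z w0"
      if "t \<in> {0..1}" "z \<in> ?Z" for t z
    proof -
      have "k (t, z) w > 0"
        using pos[OF that(2)] kden[OF that(2,1)] by (simp add: k_def)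
      moreover have "k (t, z) w \<le> z w"
        using pos[OF that(2)] kden[OF that(2,1)] that(1) by (simp add: k_def divide_le_eq)
      moreover have "k (t, z) w0 = z w0"
        using w \<tau> by (auto simp: k_def)
      ultimately show ?thesis
        using modify[OF that(2), of "k (t, z)"] by (auto simp: k_def)
    qed
    show "k (1, z) w - k (1, z) w0 < 0" if "z \<in> ?Z" for z
      using pos[OF that] w \<tau> by (auto simp: k_def divide_less_eq algebra_simps)
    show "k (0, z) = z" if "z \<in> ?Z" for z
      using pos[OF that] by (auto simp: k_def fun_eq_iff)
  qed (use conth contk in \<open>auto simp: h_def fun_eq_iff\<close>)
  moreover have "{z \<in> ?P. z w - z w0 = 0} = equal_on D \<sigma> (insert w \<tau>)"
  proof -
    have "(\<forall>a\<in>insert w \<tau>. \<forall>b\<in>insert w \<tau>. z a = z b) \<longleftrightarrow> (\<forall>a\<in>\<tau>. \<forall>b\<in>\<tau>. z a = z b) \<and> z w = z w0" for z :: "'a \<Rightarrow> real"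
      using \<tau>(2) unfolding ball_simps by metis
    then show ?thesis
      unfolding equal_on_def by simp
  qed
  ultimately show ?thesis by simp
qed

text \<open>
  One suspension for each vertex of \<open>\<sigma>\<close> other than \<open>w0\<close>.
\<close>

lemma star_suspension:
  assumes \<sigma>: "finite \<sigma>" "w0 \<in> \<sigma>"
  shows "acyclic_pair (p + int (card \<sigma>) - 1) (star D \<sigma>) (star D \<sigma> - ray D \<sigma>)
    \<longleftrightarrow> acyclic_pair p (star D \<sigma>) (star D \<sigma> - {u. supp u = \<sigma>})"
proof -
  have "acyclic_pair (p + int (card F)) (star D \<sigma>) (star D \<sigma> - equal_on D \<sigma> (insert w0 F))
      \<longleftrightarrow> acyclic_pair p (star D \<sigma>) (star D \<sigma> - equal_on D \<sigma> {w0})"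
    if "finite F" "F \<subseteq> \<sigma> - {w0}" for F
    using that
  proof (induction F)
    case (insert w F)
    then have "insert w0 F \<subseteq> \<sigma>" "w \<in> \<sigma>" "w \<notin> insert w0 F"
      using \<sigma>(2) by auto
    then show ?case
      using star_suspension_step[of "insert w0 F" \<sigma> w0 w "p + int (card F)" D] insert
      by (simp add: insert_commute algebra_simps)
  qed simp
  from this[of "\<sigma> - {w0}"] have "acyclic_pair (p + int (card \<sigma> - 1)) (star D \<sigma>) (star D \<sigma> - ray D \<sigma>)
      \<longleftrightarrow> acyclic_pair p (star D \<sigma>) (star D \<sigma> - equal_on D \<sigma> {w0})"
    using \<sigma> by (simp add: insert_absorb)
  moreover have "int (card \<sigma> - 1) = int (card \<sigma>) - 1"
    using \<sigma> by (metis card_gt_0_iff empty_iff of_nat_1 of_nat_diff One_nat_def Suc_leI)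
  moreover have "star D \<sigma> - equal_on D \<sigma> {w0} = star D \<sigma> - {u. supp u = \<sigma>}"
    by (auto simp: star_def equal_on_def)
  ultimately show ?thesis
    by (simp add: algebra_simps)
qed

text \<open>
  The local homology at an interior point of a simplex determines the homology of the star modulo the
  complement of the open simplex, with a shift by the dimension of the simplex.
\<close>

lemma acyclic_star_minus_simplex:
  assumes D: "simplicial_complex D" "\<sigma> \<in> D"
    and loc: "acyclic_pair (p + int (card \<sigma>) - 1) (cone_space D) (cone_space D - ray D \<sigma>)"
  shows "acyclic_pair p (star D \<sigma>) (star D \<sigma> - {u. supp u = \<sigma>})"
proof -
  have fin: "finite \<sigma>" and "\<sigma> \<noteq> {}"
    using D by (auto simp: simplicial_complex_def)
  then obtain w0 where w0: "w0 \<in> \<sigma>" by blast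
  have eq: "(cone_space D - ray D \<sigma>) \<union> star D \<sigma> = cone_space D"
    "(cone_space D - ray D \<sigma>) \<inter> star D \<sigma> = star D \<sigma> - ray D \<sigma>"
    by (auto simp: star_def equal_on_def)
  have "acyclic_pair (p + int (card \<sigma>) - 1) ((cone_space D - ray D \<sigma>) \<union> star D \<sigma>) (cone_space D - ray D \<sigma>)
    \<longleftrightarrow> acyclic_pair (p + int (card \<sigma>) - 1) (star D \<sigma>) ((cone_space D - ray D \<sigma>) \<inter> star D \<sigma>)"
  proof (rule acyclic_pair_excision; unfold eq)
    show "openin (top_of_set (cone_space D)) (cone_space D - ray D \<sigma>)"
      using closedin_ray[OF D(1)] by (metis openin_diff openin_topspace topspace_euclidean_subtopology)
    show "openin (top_of_set (cone_space D)) (star D \<sigma>)"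
      by (rule openin_star[OF fin])
  qed
  then show ?thesis
    using loc star_suspension[OF fin w0] by (simp add: eq)
qed

text \<open>
  The vertices of a derived complex are coloured by the dimensions of the simplexes that they come from, and the
  vertices of each of its simplexes have distinct colours. The arguments on the dimension and on the
  connectivity of colour-selected subcomplexes use only this colouring.
\<close>

locale balanced_complex =
  fixes D :: "'w set set" and c :: "'w \<Rightarrow> nat" and N :: "nat set"
  assumes complex: "simplicial_complex D"
    and finite_N: "finite N"
    and inj: "\<sigma> \<in> D \<Longrightarrow> inj_on c \<sigma>"
    and colours: "\<sigma> \<in> D \<Longrightarrow> c ` \<sigma> \<subseteq> N"
begin

abbreviation C :: "('w \<Rightarrow> real) set" where
  "C \<equiv> cone_space D"

definition has :: "nat set \<Rightarrow> ('w \<Rightarrow> real) set" where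
  "has J = {u \<in> C. J \<subseteq> c ` supp u}"

definition hit :: "nat set \<Rightarrow> ('w \<Rightarrow> real) set" where
  "hit S = {u \<in> C. c ` supp u \<inter> S \<noteq> {}}"

lemma supp_in: "u \<in> C \<Longrightarrow> supp u \<in> D"
  by (simp add: cone_space_def)

lemma finite_simplex: "\<sigma> \<in> D \<Longrightarrow> finite \<sigma>"
  using complex by (auto simp: simplicial_complex_def)

lemma openin_hit: "openin (top_of_set C) (hit S)"
proof -
  have "hit S = (\<Union>w\<in>{w. c w \<in> S}. {u \<in> C. 0 < u w})"
    using in_supp_cone[of _ D] by (auto simp: hit_def)
  then show ?thesis
    by (auto intro: openin_Union openin_coordinate_pos)
qed

text \<open>
  A point of the cone lies in the open star of exactly one simplex with colour set \<open>J\<close>, the face of its support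
  spanned by those colours.
\<close>

lemma has_eq: "J \<noteq> {} \<Longrightarrow> has J = (\<Union>\<sigma>\<in>{\<sigma> \<in> D. c ` \<sigma> = J}. star D \<sigma>)"
proof
  assume J: "J \<noteq> {}"
  show "has J \<subseteq> (\<Union>\<sigma>\<in>{\<sigma> \<in> D. c ` \<sigma> = J}. star D \<sigma>)"
  proof
    fix u assume u: "u \<in> has J"
    let ?\<sigma> = "{w \<in> supp u. c w \<in> J}"
    have "c ` ?\<sigma> = J" using u by (auto simp: has_def)
    moreover have "?\<sigma> \<in> D"
      using complex u J \<open>c ` ?\<sigma> = J\<close> supp_in[of u]
      unfolding simplicial_complex_def has_def by (metis (no_types, lifting) image_empty mem_Collect_eq subsetI)
    ultimately show "u \<in> (\<Union>\<sigma>\<in>{\<sigma> \<in> D. c ` \<sigma> = J}. star D \<sigma>)"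
      using u by (auto simp: star_def has_def intro!: exI[of _ ?\<sigma>])
  qed
qed (auto simp: has_def star_def)

lemma star_disjoint:
  assumes "c ` \<sigma> = c ` \<sigma>'" "\<sigma> \<noteq> \<sigma>'"
  shows "star D \<sigma> \<inter> star D \<sigma>' = {}"
proof (rule ccontr)
  assume "star D \<sigma> \<inter> star D \<sigma>' \<noteq> {}"
  then obtain u where u: "u \<in> C" "\<sigma> \<subseteq> supp u" "\<sigma>' \<subseteq> supp u"
    by (auto simp: star_def)
  then have "\<sigma> = \<sigma>'"
    using inj_on_image_eq_iff[OF inj[OF supp_in[OF u(1)]] u(2,3)] assms(1) by simp
  then show False using assms by simp
qed

lemma openin_has: "finite J \<Longrightarrow> openin (top_of_set C) (has J)"
proof (cases "J = {}")
  case False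
  then show ?thesis
    by (auto simp: has_eq intro!: openin_Union openin_star finite_simplex)
qed (auto simp: has_def)

lemma acyclic_has:
  assumes "J \<noteq> {}" and A: "openin (top_of_set C) A" "A \<subseteq> has J"
    and van: "\<And>\<sigma>. \<sigma> \<in> D \<Longrightarrow> c ` \<sigma> = J \<Longrightarrow> acyclic_pair p (star D \<sigma>) (A \<inter> star D \<sigma>)"
  shows "acyclic_pair p (has J) A"
proof -
  let ?I = "{\<sigma> \<in> D. c ` \<sigma> = J}"
  have sub: "has J \<subseteq> C" by (auto simp: has_def)
  have "acyclic_pair p (\<Union>\<sigma>\<in>?I. star D \<sigma>) A"
  proof (rule acyclic_pair_disjoint_union; (fold has_eq[OF assms(1)])?)
    show "openin (top_of_set (has J)) (star D \<sigma>)" if "\<sigma> \<in> ?I" for \<sigma>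
    proof (rule openin_subset_trans[OF _ _ sub])
      show "openin (top_of_set C) (star D \<sigma>)"
        using that by (intro openin_star finite_simplex) auto
      show "star D \<sigma> \<subseteq> has J"
        using that unfolding has_eq[OF assms(1)] by blast
    qed
    show "openin (top_of_set (has J)) A"
      by (rule openin_subset_trans[OF A sub])
    show "star D \<sigma> \<inter> star D \<sigma>' = {}" if "\<sigma> \<in> ?I" "\<sigma>' \<in> ?I" "\<sigma> \<noteq> \<sigma>'" for \<sigma> \<sigma>'
      by (rule star_disjoint) (use that in auto)
  qed (use van in auto)
  then show ?thesis
    by (simp add: has_eq[OF assms(1)])
qed

text \<open>
  The sets of points whose support has a vertex of a given colour form an open cover by \<open>card N\<close> sets whose
  intersections are disjoint unions of contractible stars.
\<close>

lemma acyclic_above_dimension: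
  assumes "p \<ge> int (card N)"
  shows "acyclic_pair p C {}"
proof -
  have "supp u \<noteq> {}" if "u \<in> C" for u
    using supp_in[OF that] complex by (auto simp: simplicial_complex_def)
  then have eq: "(\<Union>d\<in>N. has {d}) = C"
    using colours[OF supp_in] by (fastforce simp: has_def)
  have "acyclic_pair p (\<Union>d\<in>N. has {d}) {}"
  proof (rule acyclic_finite_open_cover[OF finite_N])
    show "openin (top_of_set C) (has {d})" for d
      by (rule openin_has) simp
    fix J and q :: int assume J: "J \<subseteq> N" "J \<noteq> {}" "q > 0"
    have "(\<Inter>d\<in>J. has {d}) = has J"
      using J by (auto simp: has_def)
    moreover have "acyclic_pair q (has J) {}"
      by (rule acyclic_has) (use J acyclic_star in auto)
    ultimately show "acyclic_pair q (\<Inter>d\<in>J. has {d}) {}" by simp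
  qed (use assms in auto)
  then show ?thesis
    by (simp add: eq)
qed

text \<open>
  Induction on the number of colours outside \<open>J \<union> S\<close>. When \<open>e\<close> is such a colour, the pair is split by
  \<open>has J \<inter> hit (insert e S)\<close>: the upper quotient is the claim for \<open>S \<union> {e}\<close>, and by excision the lower one is the
  claim for \<open>J \<union> {e}\<close>. When all colours are used and \<open>J\<close> is not empty, removing \<open>hit S\<close> from \<open>has J\<close> leaves the open simplexes
  with colour set \<open>J\<close>, and the local homology decides.
\<close>

lemma acyclic_hit:
  assumes loc: "\<And>\<sigma> q. \<sigma> \<in> D \<Longrightarrow> q < int (card N) - 1 \<Longrightarrow> acyclic_pair q C (C - ray D \<sigma>)"
    and "J \<subseteq> N" "S \<subseteq> N" "J \<inter> S = {}" "p < int (card S)"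
  shows "acyclic_pair p (has J) (has J \<inter> hit S)"
  using assms(2-)
proof (induction "card (N - J - S)" arbitrary: J S)
  case 0
  have "finite (N - J - S)"
    using finite_N by simp
  with 0 have NJS: "N = J \<union> S"
    by auto
  show ?case
  proof (cases "J = {}")
    case True
    have "has J \<subseteq> hit S"
    proof
      fix u assume "u \<in> has J"
      then have u: "u \<in> C" by (simp add: has_def)
      then have "supp u \<noteq> {}"
        using supp_in[OF u] complex by (auto simp: simplicial_complex_def)
      then show "u \<in> hit S"
        using colours[OF supp_in[OF u]] u NJS True by (auto simp: hit_def)
    qed
    then show ?thesis
      by (auto intro: acyclic_pair_self)
  next
    case False
    show ?thesis
    proof (rule acyclic_has[OF False])
      have "finite J"
        using 0 finite_N finite_subset by blast
      then show "openin (top_of_set C) (has J \<inter> hit S)"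
        by (intro openin_Int openin_has openin_hit)
      fix \<sigma> assume \<sigma>: "\<sigma> \<in> D" "c ` \<sigma> = J"
      have "card N = card \<sigma> + card S"
        using NJS 0 finite_N card_Un_disjoint[of J S] card_image[OF inj[OF \<sigma>(1)]] \<sigma>(2) by auto
      then have "acyclic_pair p (star D \<sigma>) (star D \<sigma> - {u. supp u = \<sigma>})"
        using 0 by (intro acyclic_star_minus_simplex[OF complex \<sigma>(1)] loc \<sigma>(1)) auto
      moreover have "star D \<sigma> - {u. supp u = \<sigma>} = (has J \<inter> hit S) \<inter> star D \<sigma>"
      proof -
        have "supp u \<noteq> \<sigma> \<longleftrightarrow> u \<in> has J \<inter> hit S" if "u \<in> star D \<sigma>" for u
        proof -
          have u: "u \<in> C" "\<sigma> \<subseteq> supp u" using that by (auto simp: star_def)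
          have "supp u = \<sigma> \<longleftrightarrow> c ` supp u = c ` \<sigma>"
            using inj_on_image_eq_iff[OF inj[OF supp_in[OF u(1)]] _ u(2), of "supp u"] by auto
          moreover have "c ` supp u \<noteq> J \<longleftrightarrow> c ` supp u \<inter> S \<noteq> {}"
            using colours[OF supp_in[OF u(1)]] u(2) \<sigma>(2) NJS 0 by blast
          ultimately show ?thesis
            using u \<sigma>(2) by (auto simp: has_def hit_def)
        qed
        then show ?thesis by blast
      qed
      ultimately show "acyclic_pair p (star D \<sigma>) ((has J \<inter> hit S) \<inter> star D \<sigma>)"
        by simp
    qed auto
  qed
next
  case (Suc m)
  then obtain e where e: "e \<in> N - J - S"
    by (metis card.empty ex_in_conv nat.distinct(1))
  have fin: "finite J" "finite S" "finite (N - J - S)"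
    using Suc.prems finite_N finite_subset by auto
  have m: "m = card (N - insert e J - S)" "m = card (N - J - insert e S)"
  proof -
    have "N - insert e J - S = (N - J - S) - {e}" "N - J - insert e S = (N - J - S) - {e}"
      by auto
    then show "m = card (N - insert e J - S)" "m = card (N - J - insert e S)"
      using Suc.hyps(2) e fin by (simp_all add: card_Diff_singleton)
  qed
  let ?A = "has J \<inter> hit S" and ?V = "has (insert e J)"
  have un: "?A \<union> ?V = has J \<inter> hit (insert e S)" "?A \<inter> ?V = ?V \<inter> hit S"
    by (auto simp: has_def hit_def)
  have "acyclic_pair p ?V (?V \<inter> hit S)"
    by (rule Suc.hyps(1)[OF m(1)]) (use Suc.prems e in auto)
  moreover have "acyclic_pair p (?A \<union> ?V) ?A \<longleftrightarrow> acyclic_pair p ?V (?A \<inter> ?V)"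
  proof (rule acyclic_pair_excision)
    have C: "?A \<union> ?V \<subseteq> C"
      by (auto simp: has_def)
    show "openin (top_of_set (?A \<union> ?V)) ?A"
      by (rule openin_subset_trans[OF _ _ C]) (use fin openin_has openin_hit in auto)
    show "openin (top_of_set (?A \<union> ?V)) ?V"
      by (rule openin_subset_trans[OF _ _ C]) (use fin openin_has in auto)
  qed
  ultimately have 1: "acyclic_pair p (has J \<inter> hit (insert e S)) ?A"
    by (simp add: un)
  have "acyclic_pair p (has J) (has J \<inter> hit (insert e S))"
    by (rule Suc.hyps(1)[OF m(2)]) (use Suc.prems e fin in auto)
  with 1 show ?case
    by (rule acyclic_pair_trans[rotated 2]) (auto simp: hit_def)
qed

text \<open>
  Shrinking the coordinates with colours outside \<open>S\<close> to zero deforms \<open>hit S\<close> into the subcomplex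
  selected by \<open>S\<close>.
\<close>

lemma acyclic_colour_selection:
  assumes loc: "\<And>\<sigma> q. \<sigma> \<in> D \<Longrightarrow> q < int (card N) - 1 \<Longrightarrow> acyclic_pair q C (C - ray D \<sigma>)"
    and S: "S \<subseteq> N" and p: "p < int (card S)"
  shows "acyclic_pair p C (cone_space {\<sigma> \<in> D. c ` \<sigma> \<subseteq> S})"
proof (rule acyclic_pair_trans[where B = "hit S"])
  let ?CS = "cone_space {\<sigma> \<in> D. c ` \<sigma> \<subseteq> S}"
  show "acyclic_pair p C (hit S)"
    using acyclic_hit[OF loc _ S _ p, of "{}"] by (simp add: has_def hit_def Int_def)
  show CS: "?CS \<subseteq> hit S"
  proof
    fix u assume "u \<in> ?CS"
    then have u: "u \<in> C" "c ` supp u \<subseteq> S" by (auto simp: cone_space_def)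
    then have "supp u \<noteq> {}"
      using supp_in[OF u(1)] complex by (auto simp: simplicial_complex_def)
    then show "u \<in> hit S"
      using u by (auto simp: hit_def)
  qed
  show "hit S \<subseteq> C" by (auto simp: hit_def)
  \<comment> \<open>for \<open>t < 1\<close> the support does not change\<close>
  let ?h = "\<lambda>(t :: real, u :: 'w \<Rightarrow> real) w. if c w \<in> S then u w else (1 - t) * u w"
  have end_pt: "?h (1, u) \<in> ?CS" if u: "u \<in> hit S" for u
  proof -
    have "supp (?h (1, u)) = {w \<in> supp u. c w \<in> S}"
      by (auto simp: supp_def)
    moreover have "{w \<in> supp u. c w \<in> S} \<noteq> {}"
      using u by (auto simp: hit_def)
    moreover have "{w \<in> supp u. c w \<in> S} \<in> D"
      using complex supp_in[of u] u calculation(2) unfolding simplicial_complex_def hit_def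
      by (metis (no_types, lifting) mem_Collect_eq subsetI)
    ultimately show ?thesis
      using u by (auto simp: cone_space_def hit_def)
  qed
  show "acyclic_pair p (hit S) ?CS"
  proof (rule acyclic_pair_deformation[OF CS, where h = ?h])
    have coord: "continuous_on ({0..1::real} \<times> hit S) (\<lambda>x. snd x w)" for w
      by (intro continuous_on_product_then_coordinatewise[OF continuous_on_snd] continuous_on_id)
    show "continuous_on ({0..1} \<times> hit S) ?h"
      unfolding case_prod_beta
    proof (rule continuous_on_coordinatewise_then_product)
      show "continuous_on ({0..1} \<times> hit S) (\<lambda>x. if c w \<in> S then snd x w else (1 - fst x) * snd x w)" for w
        using coord by (cases "c w \<in> S") (auto intro!: continuous_intros)
    qed
    have mid: "supp (?h (t, u)) = supp u" if "t < 1" for t u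
      using that by (auto simp: supp_def)
    have nn: "0 \<le> ?h (t, u) w" if "t \<in> {0..1}" "u \<in> C" for t u w
      using that by (auto simp: cone_space_def)
    show "?h (t, u) \<in> hit S" if "t \<in> {0..1}" "u \<in> hit S" for t u
    proof (cases "t = 1")
      case True
      then show ?thesis using end_pt[OF that(2)] CS by blast
    next
      case False
      then have "supp (?h (t, u)) = supp u"
        using that by (intro mid) auto
      then show ?thesis
        using nn[OF that(1), of u] that(2) unfolding hit_def cone_space_def by simp
    qed
    show "?h (t, u) \<in> ?CS" if "t \<in> {0..1}" "u \<in> ?CS" for t u
    proof -
      have "?h (t, u) = u"
        using that by (fastforce simp: cone_space_def supp_def)
      then show ?thesis using that by simp
    qed
  qed (use end_pt[unfolded case_prod_conv] in \<open>auto simp: hit_def\<close>)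
qed

end

section \<open>The cone over the first derived\<close>

text \<open>
  By local finiteness the points with a given positive coordinate have their supports in one finite set, and
  these open sets cover the cone.
\<close>

lemma continuous_on_cone_local:
  fixes f :: "('v \<Rightarrow> real) \<Rightarrow> 'b::topological_space"
  assumes K: "simplicial_complex K" "locally_finite K"
    and loc: "\<And>F. finite F \<Longrightarrow> continuous_on {u \<in> cone_space K. supp u \<subseteq> F} f"
  shows "continuous_on (cone_space K) f"
proof -
  let ?C = "cone_space K"
  have "continuous_map (top_of_set ?C) euclidean f"
  proof (rule pasting_lemma[where I = UNIV and T = "\<lambda>w. {u \<in> ?C. 0 < u w}" and f = "\<lambda>_. f"])
    show "openin (top_of_set ?C) {u \<in> ?C. 0 < u w}" for w
      by (rule openin_coordinate_pos)
    show "continuous_map (subtopology (top_of_set ?C) {u \<in> ?C. 0 < u w}) euclidean f" for w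
    proof -
      let ?F = "\<Union>{\<sigma> \<in> K. w \<in> \<sigma>}"
      have "finite ?F"
        using K by (auto simp: locally_finite_def simplicial_complex_def)
      then have "continuous_on {u \<in> ?C. supp u \<subseteq> ?F} f"
        by (rule loc)
      moreover have "{u \<in> ?C. 0 < u w} \<subseteq> {u \<in> ?C. supp u \<subseteq> ?F}"
        by (auto simp: cone_space_def supp_def)
      ultimately have "continuous_on {u \<in> ?C. 0 < u w} f"
        by (rule continuous_on_subset)
      moreover have "subtopology (top_of_set ?C) {u \<in> ?C. 0 < u w} = top_of_set {u \<in> ?C. 0 < u w}"
        by (rule subtopology_top_of_set) auto
      ultimately show ?thesis by simp
    qed
    show "\<exists>w. w \<in> UNIV \<and> u \<in> {u \<in> ?C. 0 < u w} \<and> f u = f u" if "u \<in> topspace (top_of_set ?C)" for u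
    proof -
      have "supp u \<noteq> {}"
        using that K by (auto simp: cone_space_def simplicial_complex_def)
      then show ?thesis
        using that in_supp_cone[of u K] by auto
    qed
  qed auto
  then show ?thesis by simp
qed

definition mass :: "('v \<Rightarrow> real) \<Rightarrow> real" where
  "mass u = (\<Sum>v\<in>supp u. u v)"

definition normalize :: "('v \<Rightarrow> real) \<Rightarrow> 'v \<Rightarrow> real" where
  "normalize u = (\<lambda>v. u v / mass u)"

definition conic :: "('v \<Rightarrow> real) set \<Rightarrow> bool" where
  "conic X \<longleftrightarrow> (\<forall>u\<in>X. \<forall>r>0. (\<lambda>v. r * u v) \<in> X)"

lemma realization_eq: "realization K = {u \<in> cone_space K. mass u = 1}"
  by (auto simp: realization_def cone_space_def mass_def)

lemma supp_scale: "r \<noteq> 0 \<Longrightarrow> supp (\<lambda>v. r * u v) = supp u"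
  by (auto simp: supp_def)

lemma mass_scale: "r \<noteq> 0 \<Longrightarrow> mass (\<lambda>v. r * u v) = r * mass u"
  by (simp add: mass_def supp_scale sum_distrib_left)

lemma conic_cone_space: "conic (cone_space K)"
  by (auto simp: conic_def cone_space_def supp_scale)

lemma mass_pos:
  assumes "simplicial_complex K" "u \<in> cone_space K"
  shows "mass u > 0"
  unfolding mass_def
proof (rule sum_pos)
  show "finite (supp u)" "supp u \<noteq> {}"
    using assms by (auto simp: cone_space_def simplicial_complex_def)
qed (use in_supp_cone[OF assms(2)] in auto)

lemma continuous_on_mass:
  assumes K: "simplicial_complex K" "locally_finite K"
  shows "continuous_on (cone_space K) mass"
proof (rule continuous_on_cone_local[OF K])
  fix F :: "'a set" assume F: "finite F"
  have "continuous_on {u \<in> cone_space K. supp u \<subseteq> F} (\<lambda>u. \<Sum>v\<in>F. u v)"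
    by (intro continuous_intros continuous_on_subset[OF continuous_on_product_coordinates subset_UNIV])
  moreover have "mass u = (\<Sum>v\<in>F. u v)" if "supp u \<subseteq> F" for u
    unfolding mass_def by (rule sum.mono_neutral_left[OF F that]) (auto simp: supp_def)
  ultimately show "continuous_on {u \<in> cone_space K. supp u \<subseteq> F} mass"
    by (subst continuous_on_cong[OF refl, where g = "\<lambda>u. \<Sum>v\<in>F. u v"]) auto
qed

lemma normalize_in:
  assumes K: "simplicial_complex K" and X: "conic X" "X \<subseteq> cone_space K" and u: "u \<in> X"
  shows "normalize u \<in> realization K \<inter> X"
proof -
  have m: "mass u > 0"
    using mass_pos[OF K] X u by blast
  have eq: "normalize u = (\<lambda>v. (1 / mass u) * u v)"
    by (simp add: normalize_def)
  have "normalize u \<in> X"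
    using X(1)[unfolded conic_def, rule_format, OF u, of "1 / mass u"] m by (simp add: eq)
  moreover have "mass (normalize u) = 1"
    using mass_scale[of "1 / mass u" u] m by (simp add: eq)
  ultimately show ?thesis
    using X(2) by (auto simp: realization_eq)
qed

text \<open>
  Dividing by the sum of the coordinates retracts the cone onto the realization, by a linear homotopy along
  rays.
\<close>

lemma acyclic_pair_normalize:
  assumes K: "simplicial_complex K" "locally_finite K"
    and X: "conic X" "X \<subseteq> cone_space K" and A: "conic A" "A \<subseteq> X"
  shows "acyclic_pair p (realization K \<inter> X) (realization K \<inter> A) \<longleftrightarrow> acyclic_pair p X A"
proof
  let ?R = "realization K"
  have mX: "continuous_on X mass"
    using continuous_on_mass[OF K] X(2) continuous_on_subset by blast
  have pos: "mass u > 0" if "u \<in> X" for u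
    using mass_pos[OF K(1)] X that by blast
  have coord: "continuous_on Y (\<lambda>u. u v)" for Y :: "('a \<Rightarrow> real) set" and v
    by (rule continuous_on_subset[OF continuous_on_product_coordinates subset_UNIV])
  have cn: "continuous_on X normalize"
    unfolding normalize_def
    by (intro continuous_on_coordinatewise_then_product continuous_intros coord mX) (use pos in fastforce)
  have nX: "normalize u \<in> ?R \<inter> X" if "u \<in> X" for u
    by (rule normalize_in[OF K(1) X that])
  have nA: "normalize u \<in> ?R \<inter> A" if "u \<in> A" for u
    by (rule normalize_in[OF K(1) A(1) _ that]) (use X A in auto)
  have nid: "normalize u = u" if "u \<in> ?R" for u
    using that by (simp add: normalize_def realization_eq)
  show "acyclic_pair p (?R \<inter> X) (?R \<inter> A)" if "acyclic_pair p X A"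
    by (rule acyclic_pair_dominated[OF that, where f = id and g = normalize and h = snd])
      (use A nX nA nid cn in \<open>auto intro: continuous_on_snd\<close>)
  show "acyclic_pair p X A" if "acyclic_pair p (?R \<inter> X) (?R \<inter> A)"
  proof (rule acyclic_pair_dominated[OF that A(2), where f = normalize and g = id
        and h = "\<lambda>(t, u) v. ((1 - t) + t / mass u) * u v"])
    have c1: "continuous_on ({0..1::real} \<times> X) (\<lambda>x. snd x v)" for v
      by (intro continuous_on_product_then_coordinatewise[OF continuous_on_snd] continuous_on_id)
    have c2: "continuous_on ({0..1::real} \<times> X) (\<lambda>x. mass (snd x))"
      by (rule continuous_on_compose2[OF mX]) (auto intro: continuous_on_snd)
    show "continuous_on ({0..1} \<times> X) (\<lambda>(t, u) v. ((1 - t) + t / mass u) * u v)"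
      unfolding case_prod_beta
      by (intro continuous_on_coordinatewise_then_product continuous_intros c1 c2) (use pos in fastforce)
    have scale: "0 < (1 - t) + t / mass u" if "t \<in> {0..1}" "u \<in> X" for t u
    proof (cases "t = 0")
      case False
      then show ?thesis
        using that pos[OF that(2)] by (intro add_nonneg_pos) auto
    qed simp
    show "(\<lambda>(t, u) v. ((1 - t) + t / mass u) * u v) (t, u) \<in> X" if "t \<in> {0..1}" "u \<in> X" for t u
      using X(1) that scale[OF that] by (auto simp: conic_def)
    show "(\<lambda>(t, u) v. ((1 - t) + t / mass u) * u v) (t, u) \<in> A" if "t \<in> {0..1}" "u \<in> A" for t u
      using A that scale[of t u] by (auto simp: conic_def)
  qed (use nX nA cn in \<open>auto simp: normalize_def\<close>)
qed

lemma simplicial_complex_derived: "simplicial_complex (derived K)"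
  unfolding simplicial_complex_def derived_def by (auto intro: finite_subset)

text \<open>
  The linear map that sends the vertex \<open>\<sigma>\<close> of the first derived to the indicator function of \<open>\<sigma>\<close>, which is
  \<open>card \<sigma>\<close> times the barycentre.
\<close>

definition unfold_chain :: "'v set set \<Rightarrow> ('v set \<Rightarrow> real) \<Rightarrow> 'v \<Rightarrow> real" where
  "unfold_chain K u = (\<lambda>v. \<Sum>\<sigma> | \<sigma> \<in> K \<and> v \<in> \<sigma>. u \<sigma>)"

text \<open>
  The inverse of \<open>unfold_chain\<close>. The coordinate at \<open>\<sigma>\<close> is the length of the interval of levels \<open>s > 0\<close> for which
  \<open>\<sigma>\<close> is the set \<open>{v. x v \<ge> s}\<close>; the inserted 0 is the lower end when \<open>\<sigma>\<close> is the whole support.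
\<close>

definition gap :: "'v set set \<Rightarrow> ('v \<Rightarrow> real) \<Rightarrow> 'v set \<Rightarrow> real" where
  "gap K x = (\<lambda>\<sigma>. if \<sigma> \<in> K then max 0 (Min (x ` \<sigma>) - Max (insert 0 (x ` (supp x - \<sigma>)))) else 0)"

lemma continuous_on_Min_coordinates:
  assumes "finite I" "I \<noteq> {}"
  shows "continuous_on X (\<lambda>x :: 'v \<Rightarrow> real. Min (x ` I))"
  using assms
proof (induction rule: finite_ne_induct)
  case (singleton v)
  then show ?case
    by (simp add: continuous_on_subset[OF continuous_on_product_coordinates subset_UNIV])
next
  case (insert v I)
  then show ?case
    by (simp add: continuous_on_min continuous_on_subset[OF continuous_on_product_coordinates subset_UNIV])
qed

lemma continuous_on_Max_coordinates:
  assumes "finite I"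
  shows "continuous_on X (\<lambda>x :: 'v \<Rightarrow> real. Max (insert 0 (x ` I)))"
  using assms
proof (induction rule: finite_induct)
  case (insert v I)
  have "Max (insert 0 (x ` insert v I)) = max (x v) (Max (insert 0 (x ` I)))" for x :: "'v \<Rightarrow> real"
    using insert.hyps by (simp add: insert_commute[of 0])
  then show ?case
    using insert by (simp add: continuous_on_max continuous_on_subset[OF continuous_on_product_coordinates subset_UNIV])
qed simp

lemma continuous_on_gap:
  assumes K: "simplicial_complex K" "locally_finite K"
  shows "continuous_on (cone_space K) (gap K)"
proof (rule continuous_on_coordinatewise_then_product)
  fix \<sigma> :: "'a set"
  show "continuous_on (cone_space K) (\<lambda>x. gap K x \<sigma>)"
  proof (cases "\<sigma> \<in> K")
    case True
    then have \<sigma>: "finite \<sigma>" "\<sigma> \<noteq> {}"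
      using K by (auto simp: simplicial_complex_def)
    show ?thesis
    proof (rule continuous_on_cone_local[OF K])
      fix F :: "'a set" assume F: "finite F"
      have "gap K x \<sigma> = max 0 (Min (x ` \<sigma>) - Max (insert 0 (x ` (F - \<sigma>))))" if "supp x \<subseteq> F" for x
      proof -
        have "insert 0 (x ` (F - \<sigma>)) = insert 0 (x ` (supp x - \<sigma>))"
          using that by (auto simp: supp_def)
        then show ?thesis
          using True by (simp add: gap_def)
      qed
      moreover have "continuous_on {u \<in> cone_space K. supp u \<subseteq> F}
          (\<lambda>x. max 0 (Min (x ` \<sigma>) - Max (insert 0 (x ` (F - \<sigma>)))))"
        using F \<sigma> by (intro continuous_intros continuous_on_max continuous_on_Min_coordinates
            continuous_on_Max_coordinates) auto
      ultimately show "continuous_on {u \<in> cone_space K. supp u \<subseteq> F} (\<lambda>x. gap K x \<sigma>)"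
        by (subst continuous_on_cong[OF refl, where g = "\<lambda>x. max 0 (Min (x ` \<sigma>) - Max (insert 0 (x ` (F - \<sigma>))))"]) auto
    qed
  next
    case False
    then show ?thesis by (simp add: gap_def)
  qed
qed

lemma continuous_on_unfold_chain:
  "continuous_on X (unfold_chain K)"
  unfolding unfold_chain_def
  by (intro continuous_on_coordinatewise_then_product continuous_intros
      continuous_on_subset[OF continuous_on_product_coordinates subset_UNIV])

lemma unfold_chain_eq:
  assumes "locally_finite K" "supp u \<subseteq> K"
  shows "unfold_chain K u v = sum u {\<tau> \<in> supp u. v \<in> \<tau>}"
  unfolding unfold_chain_def
  by (rule sum.mono_neutral_right) (use assms in \<open>auto simp: locally_finite_def supp_def conj_commute\<close>)

lemma supp_unfold_chain:
  assumes K: "locally_finite K" and u: "\<And>\<sigma>. 0 \<le> u \<sigma>" "supp u \<subseteq> K" "finite (supp u)"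
  shows "supp (unfold_chain K u) = \<Union>(supp u)"
proof -
  have "sum u {\<tau> \<in> supp u. v \<in> \<tau>} = 0 \<longleftrightarrow> v \<notin> \<Union>(supp u)" for v
    using u by (subst sum_nonneg_eq_0_iff) (auto simp: supp_def)
  then show ?thesis
    unfolding supp_def[of "unfold_chain K u"] unfold_chain_eq[OF K u(2)] by auto
qed

lemma chain_Union_in:
  assumes "c \<in> derived K" "P \<subseteq> c" "P \<noteq> {}"
  shows "\<Union>P \<in> P" "\<Inter>P \<in> P"
proof -
  have "finite P"
    using assms by (auto simp: derived_def intro: finite_subset)
  moreover have "subset.chain UNIV P"
    unfolding subset_chain_def
  proof (intro conjI ballI)
    fix X Y assume "X \<in> P" "Y \<in> P"
    then have "X \<in> c" "Y \<in> c" using assms(2) by auto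
    then show "X \<subseteq> Y \<or> Y \<subseteq> X"
      using assms(1) by (simp add: derived_def)
  qed simp
  ultimately show "\<Union>P \<in> P" "\<Inter>P \<in> P"
    using assms(3) Union_in_chain Inter_in_chain by blast+
qed

lemma unfold_chain_in:
  assumes K: "locally_finite K" and u: "u \<in> cone_space (derived K)"
  shows "unfold_chain K u \<in> cone_space K"
proof -
  have c: "supp u \<in> derived K" and nn: "0 \<le> u \<sigma>" for \<sigma>
    using u by (auto simp: cone_space_def)
  then have *: "supp u \<subseteq> K" "finite (supp u)" "supp u \<noteq> {}"
    by (auto simp: derived_def)
  have "\<Union>(supp u) \<in> K"
    using chain_Union_in(1)[OF c subset_refl] * by blast
  moreover have "0 \<le> unfold_chain K u v" for v
    unfolding unfold_chain_def by (intro sum_nonneg nn)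
  ultimately show ?thesis
    using supp_unfold_chain[OF K nn *(1,2)] by (simp add: cone_space_def)
qed

text \<open>
  Let \<open>c\<close> be the chain supporting \<open>u\<close>. The coordinate of \<open>x = unfold_chain K u\<close> at \<open>v\<close> is the sum of \<open>u\<close> over the
  members of \<open>c\<close> containing \<open>v\<close>. For \<open>\<sigma> \<in> c\<close> the minimum over \<open>\<sigma>\<close> is attained outside the next smaller member and
  is the sum over the members that contain \<open>\<sigma>\<close>; the maximum outside \<open>\<sigma>\<close> is attained in the next larger member, or
  is 0 if there is none, and it lacks just the summand \<open>u \<sigma>\<close>. For \<open>\<sigma> \<notin> c\<close> the difference is not positive: either
  \<open>x\<close> vanishes at some vertex of \<open>\<sigma>\<close>, or the smallest member of \<open>c\<close> that contains \<open>\<sigma>\<close> has a vertex outside \<open>\<sigma>\<close>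
  at which \<open>x\<close> is at least as large as at some vertex of \<open>\<sigma>\<close>.
\<close>

lemma gap_unfold_chain:
  assumes K: "simplicial_complex K" "locally_finite K" and u: "u \<in> cone_space (derived K)"
  shows "gap K (unfold_chain K u) = u"
proof
  fix \<sigma>
  define c where "c = supp u"
  define x where "x = unfold_chain K u"
  have c: "c \<in> derived K" and nn: "0 \<le> u \<tau>" for \<tau>
    using u by (auto simp: cone_space_def c_def)
  then have cK: "c \<subseteq> K" and fin: "finite c" and comparable: "\<And>\<tau> \<tau>'. \<tau> \<in> c \<Longrightarrow> \<tau>' \<in> c \<Longrightarrow> \<tau> \<subseteq> \<tau>' \<or> \<tau>' \<subseteq> \<tau>"
    by (auto simp: derived_def)
  have x: "x v = sum u {\<tau> \<in> c. v \<in> \<tau>}" for v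
    unfolding x_def c_def by (rule unfold_chain_eq[OF K(2)]) (use cK in \<open>simp add: c_def\<close>)
  have supp_x: "supp x = \<Union>c"
    unfolding x_def c_def by (rule supp_unfold_chain[OF K(2) nn]) (use cK fin in \<open>auto simp: c_def\<close>)
  have finx: "finite (supp x)"
  proof -
    have "finite \<tau>" if "\<tau> \<in> c" for \<tau>
      using that cK K(1) by (auto simp: simplicial_complex_def)
    then show ?thesis
      using supp_x fin by simp
  qed
  have mono: "sum u S \<le> sum u T" if "S \<subseteq> T" "T \<subseteq> c" for S T
    by (rule sum_mono2) (use that fin nn finite_subset in auto)
  let ?M = "insert 0 (x ` (supp x - \<sigma>))"
  have below: "\<Union>{\<tau> \<in> c. \<tau> \<subset> \<rho>} \<subset> \<rho>" if "\<rho> \<noteq> {}" for \<rho>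
  proof (cases "{\<tau> \<in> c. \<tau> \<subset> \<rho>} = {}")
    case True
    then show ?thesis using that by (simp only: True) auto
  next
    case False
    then show ?thesis
      using chain_Union_in(1)[OF c _ False] by auto
  qed
  show "gap K (unfold_chain K u) \<sigma> = u \<sigma>"
  proof (cases "\<sigma> \<in> K")
    case False
    then have "u \<sigma> = 0"
      using cK by (auto simp: c_def supp_def)
    then show ?thesis using False by (simp add: gap_def)
  next
    case \<sigma>K: True
    then have \<sigma>: "finite \<sigma>" "\<sigma> \<noteq> {}"
      using K by (auto simp: simplicial_complex_def)
    have gap: "gap K x \<sigma> = max 0 (Min (x ` \<sigma>) - Max ?M)"
      using \<sigma>K by (simp add: gap_def)
    show ?thesis
    proof (cases "\<sigma> \<in> c")
      case True
      let ?Q = "{\<tau> \<in> c. \<sigma> \<subset> \<tau>}"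
      have Q: "{\<tau> \<in> c. \<sigma> \<subseteq> \<tau>} = insert \<sigma> ?Q"
        using True by auto
      have "Min (x ` \<sigma>) = sum u {\<tau> \<in> c. \<sigma> \<subseteq> \<tau>}"
      proof (rule Min_eqI)
        show "sum u {\<tau> \<in> c. \<sigma> \<subseteq> \<tau>} \<le> y" if "y \<in> x ` \<sigma>" for y
          using that by (auto simp: x intro!: mono)
        obtain v where v: "v \<in> \<sigma>" "v \<notin> \<Union>{\<tau> \<in> c. \<tau> \<subset> \<sigma>}"
          using below[OF \<sigma>(2)] by blast
        then have "{\<tau> \<in> c. v \<in> \<tau>} = {\<tau> \<in> c. \<sigma> \<subseteq> \<tau>}"
          using comparable True by blast
        then show "sum u {\<tau> \<in> c. \<sigma> \<subseteq> \<tau>} \<in> x ` \<sigma>"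
          using v x[of v] by (metis imageI)
      qed (use \<sigma> in simp)
      also have "\<dots> = u \<sigma> + sum u ?Q"
        unfolding Q using fin by simp
      finally have 1: "Min (x ` \<sigma>) = u \<sigma> + sum u ?Q" .
      have 2: "Max ?M = sum u ?Q"
      proof (rule Max_eqI)
        show "y \<le> sum u ?Q" if "y \<in> ?M" for y
          using that comparable True by (auto simp: x intro!: sum_nonneg nn mono)
        show "sum u ?Q \<in> ?M"
        proof (cases "?Q = {}")
          case True
          then show ?thesis by (simp only: True) simp
        next
          case False
          then have "\<Inter>?Q \<in> ?Q"
            by (intro chain_Union_in(2)[OF c]) auto
          then obtain v where v: "v \<in> \<Inter>?Q" "v \<notin> \<sigma>" "v \<in> \<Union>c"
            by blast
          then have "{\<tau> \<in> c. v \<in> \<tau>} = ?Q"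
            using comparable True by blast
          then show ?thesis
            using v x[of v] supp_x by (metis DiffI imageI insertI2)
        qed
      qed (use finx in simp)
      show ?thesis
        using gap nn[of \<sigma>] unfolding 1 2 x_def[symmetric] by simp
    next
      case False
      have "Min (x ` \<sigma>) \<le> Max ?M"
      proof (cases "\<sigma> \<subseteq> \<Union>c")
        case no: False
        then obtain v where v: "v \<in> \<sigma>" "v \<notin> \<Union>c" by blast
        then have "x v = 0"
          using supp_x by (auto simp: supp_def)
        then have "Min (x ` \<sigma>) \<le> 0"
          using \<sigma> v by (metis Min_le finite_imageI imageI)
        also have "0 \<le> Max ?M"
          using finx by simp
        finally show ?thesis .
      next
        case True
        let ?Q = "{\<tau> \<in> c. \<sigma> \<subseteq> \<tau>}"
        have "c \<noteq> {}"
          using c by (simp add: derived_def)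
        then have "\<Union>c \<in> ?Q"
          using chain_Union_in(1)[OF c subset_refl] True by auto
        then have ne: "?Q \<noteq> {}" by blast
        define \<rho> where "\<rho> = \<Inter>?Q"
        have \<rho>: "\<rho> \<in> ?Q"
          unfolding \<rho>_def by (rule chain_Union_in(2)[OF c _ ne]) auto
        then have \<rho>_ne: "\<rho> \<noteq> {}"
          using \<sigma> by auto
        have "\<not> \<sigma> \<subseteq> \<Union>{\<tau> \<in> c. \<tau> \<subset> \<rho>}"
        proof
          assume le: "\<sigma> \<subseteq> \<Union>{\<tau> \<in> c. \<tau> \<subset> \<rho>}"
          then have "{\<tau> \<in> c. \<tau> \<subset> \<rho>} \<noteq> {}"
            using \<sigma> by auto
          then have "\<Union>{\<tau> \<in> c. \<tau> \<subset> \<rho>} \<in> {\<tau> \<in> c. \<tau> \<subset> \<rho>}"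
            by (intro chain_Union_in(1)[OF c]) auto
          then have "\<rho> \<subseteq> \<Union>{\<tau> \<in> c. \<tau> \<subset> \<rho>}"
            using le unfolding \<rho>_def by blast
          then show False
            using below[OF \<rho>_ne] by blast
        qed
        then obtain v where v: "v \<in> \<sigma>" "v \<notin> \<Union>{\<tau> \<in> c. \<tau> \<subset> \<rho>}"
          by blast
        have "\<sigma> \<noteq> \<rho>" "\<sigma> \<subseteq> \<rho>"
          using \<rho> False by auto
        then obtain v' where v': "v' \<in> \<rho>" "v' \<notin> \<sigma>"
          by blast
        have "Min (x ` \<sigma>) \<le> x v"
          using \<sigma> v by simp
        also have "x v \<le> x v'"
          unfolding x
        proof (rule mono)
          show "{\<tau> \<in> c. v \<in> \<tau>} \<subseteq> {\<tau> \<in> c. v' \<in> \<tau>}"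
            using v v' \<rho> comparable by blast
        qed auto
        also have "x v' \<le> Max ?M"
          using v' \<rho> supp_x finx by (intro Max_ge) auto
        finally show ?thesis .
      qed
      moreover have "u \<sigma> = 0"
        using False by (auto simp: c_def supp_def)
      ultimately show ?thesis
        using gap unfolding x_def[symmetric] by simp
    qed
  qed
qed

text \<open>
  Subtract from \<open>x\<close> its minimum \<open>m\<close> over its support and recurse. The support is added to the chain with
  coordinate \<open>m\<close>; it properly contains all simplexes used later.
\<close>

lemma unfold_chain_onto_aux:
  assumes K: "simplicial_complex K" "locally_finite K"
    and x: "\<And>v. 0 \<le> x v" "supp x \<in> K \<or> supp x = {}" "finite (supp x)"
  shows "\<exists>u. (\<forall>\<sigma>. 0 \<le> u \<sigma>) \<and> supp u \<subseteq> K \<and> finite (supp u) \<and> (\<forall>\<sigma>\<in>supp u. \<forall>\<tau>\<in>supp u. \<sigma> \<subseteq> \<tau> \<or> \<tau> \<subseteq> \<sigma>)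
    \<and> (\<forall>\<sigma>\<in>supp u. \<sigma> \<subseteq> supp x) \<and> unfold_chain K u = x"
  using x
proof (induction "card (supp x)" arbitrary: x rule: less_induct)
  case less
  show ?case
  proof (cases "supp x = {}")
    case True
    then have "x = (\<lambda>v. 0)"
      by (auto simp: supp_def)
    then show ?thesis
      by (intro exI[of _ "\<lambda>_. 0"]) (auto simp: supp_def unfold_chain_def)
  next
    case False
    define s where "s = supp x"
    define m where "m = Min (x ` s)"
    define y where "y = (\<lambda>v. if v \<in> s then x v - m else 0)"
    have s: "finite s" "s \<noteq> {}" "s \<in> K"
      using less.prems False by (auto simp: s_def)
    have m_le: "m \<le> x v" if "v \<in> s" for v
      using that s by (simp add: m_def)
    have "m \<in> x ` s"
      unfolding m_def by (rule Min_in) (use s in auto)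
    then obtain v0 where v0: "v0 \<in> s" "x v0 = m"
      by auto
    then have "m \<noteq> 0"
      by (auto simp: s_def supp_def)
    then have m: "m > 0"
      using v0 less.prems(1)[of v0] by simp
    have ys: "supp y \<subseteq> s" "v0 \<notin> supp y"
      using v0 by (auto simp: y_def supp_def)
    have lt: "supp y \<subset> s"
      using ys v0 by auto
    have "\<exists>u. (\<forall>\<sigma>. 0 \<le> u \<sigma>) \<and> supp u \<subseteq> K \<and> finite (supp u) \<and> (\<forall>\<sigma>\<in>supp u. \<forall>\<tau>\<in>supp u. \<sigma> \<subseteq> \<tau> \<or> \<tau> \<subseteq> \<sigma>)
      \<and> (\<forall>\<sigma>\<in>supp u. \<sigma> \<subseteq> supp y) \<and> unfold_chain K u = y"
    proof (rule less.hyps)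
      show "card (supp y) < card (supp x)"
        using lt s by (simp add: psubset_card_mono flip: s_def)
      show "0 \<le> y v" for v
        using m_le by (simp add: y_def)
      show "supp y \<in> K \<or> supp y = {}"
        using K(1) s(3) ys(1) unfolding simplicial_complex_def by blast
      show "finite (supp y)"
        using ys(1) s(1) finite_subset by blast
    qed
    then obtain u where u: "\<forall>\<sigma>. 0 \<le> u \<sigma>" "supp u \<subseteq> K" "finite (supp u)"
      "\<forall>\<sigma>\<in>supp u. \<forall>\<tau>\<in>supp u. \<sigma> \<subseteq> \<tau> \<or> \<tau> \<subseteq> \<sigma>" "\<forall>\<sigma>\<in>supp u. \<sigma> \<subseteq> supp y" "unfold_chain K u = y"
      by blast
    have us: "u s = 0"
      using u(5) lt by (auto simp: supp_def)
    define u' where "u' = u(s := m)"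
    have supp': "supp u' = insert s (supp u)"
      using m us by (auto simp: u'_def supp_def)
    have below: "\<sigma> \<subseteq> s" if "\<sigma> \<in> supp u" for \<sigma>
      using u(5) ys(1) that by blast
    have "unfold_chain K u' v = x v" for v
    proof -
      have fin: "finite {\<sigma> \<in> K. v \<in> \<sigma>}"
        using K(2) by (simp add: locally_finite_def)
      have "u' \<sigma> = u \<sigma> + (if \<sigma> = s then m else 0)" for \<sigma>
        using us by (simp add: u'_def)
      then have "unfold_chain K u' v = unfold_chain K u v + (\<Sum>\<sigma> | \<sigma> \<in> K \<and> v \<in> \<sigma>. if \<sigma> = s then m else 0)"
        by (simp add: unfold_chain_def sum.distrib)
      also have "(\<Sum>\<sigma> | \<sigma> \<in> K \<and> v \<in> \<sigma>. if \<sigma> = s then m else 0) = (if v \<in> s then m else 0)"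
        using fin s(3) by (simp add: sum.delta)
      also have "unfold_chain K u v + (if v \<in> s then m else 0) = x v"
        using u(6) by (auto simp: y_def s_def supp_def)
      finally show ?thesis .
    qed
    moreover have "0 \<le> u' \<sigma>" for \<sigma>
      using u(1) m by (simp add: u'_def)
    moreover have "\<forall>\<sigma>\<in>supp u'. \<forall>\<tau>\<in>supp u'. \<sigma> \<subseteq> \<tau> \<or> \<tau> \<subseteq> \<sigma>"
      unfolding supp' using u(4) below by blast
    moreover have "\<forall>\<sigma>\<in>supp u'. \<sigma> \<subseteq> supp x"
      unfolding supp' using below by (simp add: s_def)
    moreover have "supp u' \<subseteq> K" "finite (supp u')"
      unfolding supp' using u s by auto
    ultimately show ?thesis
      by (intro exI[of _ u']) auto
  qed
qed

lemma homeomorphism_unfold_chain: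
  assumes K: "simplicial_complex K" "locally_finite K"
  shows "homeomorphism (cone_space (derived K)) (cone_space K) (unfold_chain K) (gap K)"
proof -
  have onto: "\<exists>u\<in>cone_space (derived K). unfold_chain K u = x" if x: "x \<in> cone_space K" for x
  proof -
    have "finite (supp x)" "supp x \<noteq> {}"
      using x K(1) by (auto simp: cone_space_def simplicial_complex_def)
    then obtain u where u: "\<forall>\<sigma>. 0 \<le> u \<sigma>" "supp u \<subseteq> K" "finite (supp u)"
      "\<forall>\<sigma>\<in>supp u. \<forall>\<tau>\<in>supp u. \<sigma> \<subseteq> \<tau> \<or> \<tau> \<subseteq> \<sigma>" "unfold_chain K u = x"
      using unfold_chain_onto_aux[OF K, of x] x by (auto simp: cone_space_def)
    have "supp u \<noteq> {}"
    proof
      assume "supp u = {}"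
      then have "supp x = {}"
        using supp_unfold_chain[of K u] K u by auto
      then show False using \<open>supp x \<noteq> {}\<close> by simp
    qed
    then show ?thesis
      using u by (auto simp: cone_space_def derived_def)
  qed
  have eq: "gap K (unfold_chain K u) = u" if "u \<in> cone_space (derived K)" for u
    by (rule gap_unfold_chain[OF K that])
  show ?thesis
    unfolding homeomorphism_def
  proof (intro conjI ballI)
    show "unfold_chain K ` cone_space (derived K) = cone_space K"
      using onto unfold_chain_in[OF K(2)] by blast
    show "gap K ` cone_space K = cone_space (derived K)"
    proof
      show "gap K ` cone_space K \<subseteq> cone_space (derived K)"
        using onto eq by force
      show "cone_space (derived K) \<subseteq> gap K ` cone_space K"
        using eq unfold_chain_in[OF K(2)] by (metis imageI subsetI)
    qed
    show "unfold_chain K (gap K x) = x" if "x \<in> cone_space K" for x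
      using onto[OF that] eq by force
  qed (use eq continuous_on_unfold_chain continuous_on_gap[OF K] in auto)
qed

lemma mass_unfold_chain:
  assumes K: "simplicial_complex K" "locally_finite K" and u: "u \<in> cone_space (derived K)"
  shows "mass (unfold_chain K u) = (\<Sum>\<sigma>\<in>supp u. real (card \<sigma>) * u \<sigma>)"
proof -
  have c: "supp u \<in> derived K" and nn: "0 \<le> u \<sigma>" for \<sigma>
    using u by (auto simp: cone_space_def)
  then have *: "supp u \<subseteq> K" "finite (supp u)"
    by (auto simp: derived_def)
  have fin: "finite \<sigma>" if "\<sigma> \<in> supp u" for \<sigma>
    using that * K(1) by (auto simp: simplicial_complex_def)
  let ?V = "\<Union>(supp u)"
  have finV: "finite ?V"
    using fin * by simp
  have "mass (unfold_chain K u) = (\<Sum>v\<in>?V. sum u {\<tau> \<in> supp u. v \<in> \<tau>})"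
    unfolding mass_def supp_unfold_chain[OF K(2) nn *] by (rule sum.cong[OF refl unfold_chain_eq[OF K(2) *(1)]])
  also have "\<dots> = (\<Sum>v\<in>?V. \<Sum>\<tau>\<in>supp u. if v \<in> \<tau> then u \<tau> else 0)"
    using * by (simp add: sum.inter_filter)
  also have "\<dots> = (\<Sum>\<tau>\<in>supp u. \<Sum>v\<in>?V. if v \<in> \<tau> then u \<tau> else 0)"
    by (rule sum.swap)
  also have "\<dots> = (\<Sum>\<tau>\<in>supp u. real (card \<tau>) * u \<tau>)"
  proof (rule sum.cong[OF refl])
    fix \<tau> assume "\<tau> \<in> supp u"
    then have "{v \<in> ?V. v \<in> \<tau>} = \<tau>" by auto
    then show "(\<Sum>v\<in>?V. if v \<in> \<tau> then u \<tau> else 0) = real (card \<tau>) * u \<tau>"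
      using sum.inter_filter[OF finV, of "\<lambda>_. u \<tau>" "\<lambda>v. v \<in> \<tau>"] by simp
  qed
  finally show ?thesis .
qed

text \<open>
  Dividing the barycentric coordinate at \<open>\<sigma>\<close> by \<open>card \<sigma>\<close> turns a convex combination of barycentres into
  a value of \<open>unfold_chain\<close>, and the sum of the coordinates agrees with the mass of the image.
\<close>

lemma derived_space_eq:
  assumes K: "simplicial_complex K" "locally_finite K" and L: "L \<subseteq> derived K"
  shows "derived_space L = realization K \<inter> unfold_chain K ` cone_space L"
proof -
  have card_pos: "card \<sigma> > 0" if "\<sigma> \<in> K" for \<sigma>
    using that K(1) by (auto simp: simplicial_complex_def card_gt_0_iff)
  have LD: "cone_space L \<subseteq> cone_space (derived K)"
    using L by (auto simp: cone_space_def)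
  have chainK: "supp t \<subseteq> K" "finite (supp t)" if "t \<in> cone_space L" for t
    using that L by (auto simp: cone_space_def derived_def)
  define w where "w = (\<lambda>(t :: 'a set \<Rightarrow> real) \<sigma>. t \<sigma> / real (card \<sigma>))"
  have supp_w: "supp (w t) = supp t" if "supp t \<subseteq> K" for t
    using that card_pos by (fastforce simp: w_def supp_def)
  have w_in: "w t \<in> cone_space L \<longleftrightarrow> t \<in> cone_space L" if "supp t \<subseteq> K" for t
  proof -
    have "0 \<le> w t \<sigma> \<longleftrightarrow> 0 \<le> t \<sigma>" for \<sigma>
    proof (cases "t \<sigma> = 0")
      case False
      then have "card \<sigma> > 0"
        using that card_pos by (auto simp: supp_def)
      then show ?thesis
        by (simp add: w_def zero_le_divide_iff)
    qed (simp add: w_def)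
    then show ?thesis
      by (simp add: cone_space_def supp_w[OF that])
  qed
  have image: "(\<lambda>v. \<Sum>\<sigma>\<in>supp t. t \<sigma> * barycentre \<sigma> v) = unfold_chain K (w t)" if t: "t \<in> cone_space L" for t
  proof
    fix v
    have "(\<Sum>\<sigma>\<in>supp t. t \<sigma> * barycentre \<sigma> v) = (\<Sum>\<sigma>\<in>supp t. if v \<in> \<sigma> then w t \<sigma> else 0)"
      by (rule sum.cong) (auto simp: barycentre_def w_def)
    also have "\<dots> = unfold_chain K (w t) v"
      using unfold_chain_eq[OF K(2), of "w t" v] supp_w[OF chainK(1)[OF t]] chainK[OF t]
      by (simp add: sum.inter_filter)
    finally show "(\<Sum>\<sigma>\<in>supp t. t \<sigma> * barycentre \<sigma> v) = unfold_chain K (w t) v" .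
  qed
  have mass: "mass (unfold_chain K (w t)) = mass t" if t: "t \<in> cone_space L" for t
  proof -
    have "w t \<in> cone_space (derived K)"
      using w_in[OF chainK(1)[OF t]] t LD by blast
    from mass_unfold_chain[OF K this]
    have "mass (unfold_chain K (w t)) = (\<Sum>\<sigma>\<in>supp t. real (card \<sigma>) * w t \<sigma>)"
      unfolding supp_w[OF chainK(1)[OF t]] .
    also have "\<dots> = mass t"
      unfolding mass_def
    proof (rule sum.cong[OF refl])
      fix \<sigma> assume "\<sigma> \<in> supp t"
      then have "card \<sigma> > 0"
        using chainK(1)[OF t] card_pos by blast
      then show "real (card \<sigma>) * w t \<sigma> = t \<sigma>"
        by (simp add: w_def)
    qed
    finally show ?thesis .
  qed
  show ?thesis
  proof
    show "derived_space L \<subseteq> realization K \<inter> unfold_chain K ` cone_space L"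
    proof
      fix x assume "x \<in> derived_space L"
      then obtain t where t: "t \<in> cone_space L" "mass t = 1" "x = unfold_chain K (w t)"
        using image by (auto simp: derived_space_def realization_eq)
      then have "w t \<in> cone_space L"
        using w_in[OF chainK(1)[OF t(1)]] by simp
      then show "x \<in> realization K \<inter> unfold_chain K ` cone_space L"
        using t mass[OF t(1)] unfold_chain_in[OF K(2)] LD by (auto simp: realization_eq)
    qed
    show "realization K \<inter> unfold_chain K ` cone_space L \<subseteq> derived_space L"
    proof
      fix x assume "x \<in> realization K \<inter> unfold_chain K ` cone_space L"
      then obtain u where u: "u \<in> cone_space L" "x = unfold_chain K u" "mass x = 1"
        by (auto simp: realization_eq)
      define t where "t = (\<lambda>\<sigma>. real (card \<sigma>) * u \<sigma>)"
      have wt: "w t = u"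
      proof
        fix \<sigma> show "w t \<sigma> = u \<sigma>"
          using chainK(1)[OF u(1)] card_pos[of \<sigma>] by (cases "u \<sigma> = 0") (auto simp: w_def t_def supp_def)
      qed
      have "supp t \<subseteq> K"
        using chainK(1)[OF u(1)] by (auto simp: t_def supp_def)
      then have t: "t \<in> cone_space L"
        using w_in[of t] u(1) wt by simp
      then have "mass t = 1"
        using mass[OF t] u wt by simp
      then show "x \<in> derived_space L"
        using t image[OF t] wt u by (auto simp: derived_space_def realization_eq intro!: image_eqI[of _ _ t])
    qed
  qed
qed

lemma conic_unfold_chain: "conic X \<Longrightarrow> conic (unfold_chain K ` X)"
proof -
  have "(\<lambda>v. r * unfold_chain K u v) = unfold_chain K (\<lambda>\<sigma>. r * u \<sigma>)" for r u
    by (simp add: unfold_chain_def sum_distrib_left)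
  then show "conic X \<Longrightarrow> conic (unfold_chain K ` X)"
    by (auto simp: conic_def)
qed

lemma acyclic_pair_derived_space:
  assumes K: "simplicial_complex K" "locally_finite K" and L: "L \<subseteq> M" "M \<subseteq> derived K"
    and van: "acyclic_pair p (cone_space M) (cone_space L)"
  shows "acyclic_pair p (derived_space M) (derived_space L)"
proof -
  let ?f = "unfold_chain K"
  have sub: "cone_space L \<subseteq> cone_space M" "cone_space M \<subseteq> cone_space (derived K)"
    using L by (auto simp: cone_space_def)
  have hom: "homeomorphism (cone_space M) (?f ` cone_space M) ?f (gap K)"
    by (rule homeomorphism_of_subsets[OF homeomorphism_unfold_chain[OF K]]) (use sub in auto)
  have "acyclic_pair p (?f ` cone_space M) (?f ` cone_space L)"
  proof (rule acyclic_pair_homeomorphic[OF van])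
    show "homeomorphism (?f ` cone_space M) (cone_space M) (gap K) ?f"
      using hom by (simp add: homeomorphism_symD)
    have "gap K (?f u) = u" if "u \<in> cone_space L" for u
      using gap_unfold_chain[OF K] that sub by blast
    then show "gap K ` ?f ` cone_space L = cone_space L"
      by (force simp: image_image)
  qed (use sub in auto)
  moreover have "?f ` cone_space M \<subseteq> cone_space K"
    using unfold_chain_in[OF K(2)] sub by blast
  ultimately have "acyclic_pair p (realization K \<inter> ?f ` cone_space M) (realization K \<inter> ?f ` cone_space L)"
    using sub by (subst acyclic_pair_normalize[OF K]) (auto intro!: conic_unfold_chain conic_cone_space)
  then show ?thesis
    using L by (simp add: derived_space_eq[OF K])
qed

lemma derived_space_derived:
  assumes K: "simplicial_complex K" "locally_finite K"
  shows "derived_space (derived K) = realization K"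
  using derived_space_eq[OF K subset_refl] homeomorphism_unfold_chain[OF K]
  by (auto simp: homeomorphism_def realization_eq)

text \<open>
  The ray over \<open>\<sigma>\<close> corresponds to one point of the realization, at which the local homology is known.
\<close>

lemma acyclic_ray_complement:
  assumes K: "simplicial_complex K" "locally_finite K" and \<sigma>: "\<sigma> \<in> derived K"
    and loc: "\<And>x. x \<in> realization K \<Longrightarrow> acyclic_pair p (realization K) (realization K - {x})"
  shows "acyclic_pair p (cone_space (derived K)) (cone_space (derived K) - ray (derived K) \<sigma>)"
proof -
  let ?f = "unfold_chain K" and ?D = "derived K"
  define b where "b = (\<lambda>\<tau>. if \<tau> \<in> \<sigma> then 1 else 0 :: real)"
  have "supp b = \<sigma>"
    by (auto simp: b_def supp_def)
  then have b: "b \<in> ray ?D \<sigma>"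
    using \<sigma> by (auto simp: equal_on_def cone_space_def b_def)
  have ray: "\<exists>r>0. u = (\<lambda>\<tau>. r * b \<tau>)" if u: "u \<in> ray ?D \<sigma>" for u
  proof -
    have "\<sigma> \<noteq> {}"
      using \<sigma> by (simp add: derived_def)
    then obtain \<tau> where \<tau>: "\<tau> \<in> \<sigma>" by blast
    have "u \<tau>' = u \<tau> * b \<tau>'" for \<tau>'
    proof (cases "\<tau>' \<in> \<sigma>")
      case True
      then have "u \<tau>' = u \<tau>"
        using u \<tau> unfolding equal_on_def by blast
      then show ?thesis using True by (simp add: b_def)
    next
      case False
      then have "\<tau>' \<notin> supp u"
        using u by (simp add: equal_on_def)
      then show ?thesis using False by (simp add: b_def supp_def)
    qed
    moreover have "u \<tau> > 0"
    proof -
      have "u \<in> cone_space ?D" "\<tau> \<in> supp u"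
        using u \<tau> by (simp_all add: equal_on_def)
      then show ?thesis
        using in_supp_cone[of u ?D \<tau>] by simp
    qed
    ultimately show ?thesis by blast
  qed
  have ray_sub: "ray ?D \<sigma> \<subseteq> cone_space ?D"
    by (auto simp: equal_on_def)
  have fin: "?f b \<in> cone_space K"
    using unfold_chain_in[OF K(2)] b ray_sub by blast
  define x where "x = normalize (?f b)"
  have x: "x \<in> realization K"
    using normalize_in[OF K(1) conic_cone_space subset_refl fin] by (simp add: x_def)
  have scale: "?f (\<lambda>\<tau>. r * b \<tau>) = (\<lambda>v. r * ?f b v)" for r
    by (simp add: unfold_chain_def sum_distrib_left)
  have ray_conic: "conic (ray ?D \<sigma>)"
    unfolding conic_def
  proof (intro ballI allI impI)
    fix u and r :: real assume u: "u \<in> ray ?D \<sigma>" and r: "r > 0"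
    have "(\<lambda>v. r * u v) \<in> cone_space ?D"
      using conic_cone_space[of ?D, unfolded conic_def] u r ray_sub by blast
    then show "(\<lambda>v. r * u v) \<in> ray ?D \<sigma>"
      unfolding equal_on_def mem_Collect_eq
    proof (intro conjI ballI)
      show "supp (\<lambda>v. r * u v) = \<sigma>"
        using u supp_scale[of r u] r unfolding equal_on_def by simp
      show "r * u w = r * u w'" if "w \<in> \<sigma>" "w' \<in> \<sigma>" for w w'
      proof -
        have "u w = u w'" using u that unfolding equal_on_def by blast
        then show ?thesis by (rule arg_cong)
      qed
    qed
  qed
  have "realization K \<inter> ?f ` ray ?D \<sigma> = {x}"
  proof -
    have "x = ?f (\<lambda>\<tau>. (1 / mass (?f b)) * b \<tau>)"
      unfolding scale by (simp add: x_def normalize_def)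
    moreover have "(\<lambda>\<tau>. (1 / mass (?f b)) * b \<tau>) \<in> ray ?D \<sigma>"
      using ray_conic[unfolded conic_def, rule_format, OF b, of "1 / mass (?f b)"] mass_pos[OF K(1) fin] by simp
    ultimately have "x \<in> ?f ` ray ?D \<sigma>" by blast
    moreover have "y = x" if y: "y \<in> realization K" "y \<in> ?f ` ray ?D \<sigma>" for y
    proof -
      obtain r where r: "r > 0" "y = (\<lambda>v. r * ?f b v)"
        using y(2) ray scale by blast
      then have "r * mass (?f b) = 1"
        using y(1) mass_scale[of r "?f b"] by (simp add: realization_eq)
      then have "r = 1 / mass (?f b)"
        using mass_pos[OF K(1) fin] by (simp add: field_simps)
      then show ?thesis
        using r by (simp add: x_def normalize_def)
    qed
    ultimately show ?thesis using x by blast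
  qed
  then have eqx: "realization K \<inter> (cone_space K - ?f ` ray ?D \<sigma>) = realization K - {x}"
    by (auto simp: realization_eq)
  have "conic (cone_space K - ?f ` ray ?D \<sigma>)"
    unfolding conic_def
  proof (intro ballI allI impI)
    fix u and r :: real assume u: "u \<in> cone_space K - ?f ` ray ?D \<sigma>" and r: "r > 0"
    have "(\<lambda>v. r * u v) \<notin> ?f ` ray ?D \<sigma>"
    proof
      assume "(\<lambda>v. r * u v) \<in> ?f ` ray ?D \<sigma>"
      then have "(\<lambda>v. (1 / r) * (r * u v)) \<in> ?f ` ray ?D \<sigma>"
        by (rule conic_unfold_chain[OF ray_conic, of K, unfolded conic_def, rule_format]) (use r in simp)
      then show False using u r by simp
    qed
    then show "(\<lambda>v. r * u v) \<in> cone_space K - ?f ` ray ?D \<sigma>"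
      using u r conic_cone_space[of K] by (auto simp: conic_def)
  qed
  moreover have "realization K \<inter> cone_space K = realization K"
    by (auto simp: realization_eq)
  ultimately have "acyclic_pair p (cone_space K) (cone_space K - ?f ` ray ?D \<sigma>)"
    using acyclic_pair_normalize[OF K conic_cone_space subset_refl, of "cone_space K - ?f ` ray ?D \<sigma>" p]
      loc[OF x] eqx by simp
  then show ?thesis
  proof (rule acyclic_pair_homeomorphic[OF _ _ homeomorphism_unfold_chain[OF K]])
    have "inj_on ?f (cone_space ?D)"
      using gap_unfold_chain[OF K] by (metis inj_onI)
    then show "?f ` (cone_space ?D - ray ?D \<sigma>) = cone_space K - ?f ` ray ?D \<sigma>"
      using inj_on_image_set_diff[of ?f "cone_space ?D" "cone_space ?D" "ray ?D \<sigma>"] ray_sub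
        homeomorphism_unfold_chain[OF K] by (auto simp: homeomorphism_def)
  qed auto
qed

text \<open>
  Nested finite simplexes of equal dimension coincide.
\<close>

lemma balanced_derived:
  assumes K: "simplicial_complex K" and N: "finite N"
    and L: "L \<subseteq> derived K" "simplicial_complex L" "\<And>c. c \<in> L \<Longrightarrow> simplex_dim ` c \<subseteq> N"
  shows "balanced_complex L simplex_dim N"
proof
  fix c assume "c \<in> L"
  then have c: "c \<in> derived K" using L by blast
  show "inj_on simplex_dim c"
  proof (rule inj_onI)
    fix \<sigma> \<tau> assume st: "\<sigma> \<in> c" "\<tau> \<in> c" "simplex_dim \<sigma> = simplex_dim \<tau>"
    then have "finite \<sigma>" "\<sigma> \<noteq> {}" "finite \<tau>" "\<tau> \<noteq> {}"
      using c K by (auto simp: derived_def simplicial_complex_def)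
    moreover from this have "card \<sigma> > 0" "card \<tau> > 0"
      by (auto simp: card_gt_0_iff)
    then have "card \<sigma> = card \<tau>"
      using st(3) by (simp add: simplex_dim_def)
    moreover have "\<sigma> \<subseteq> \<tau> \<or> \<tau> \<subseteq> \<sigma>"
      using c st by (simp add: derived_def)
    ultimately show "\<sigma> = \<tau>"
      using card_subset_eq by metis
  qed
qed (use assms in auto)

lemma simplex_dim_le:
  assumes "principal_complex n K" "\<sigma> \<in> K"
  shows "simplex_dim \<sigma> \<le> n"
proof -
  obtain \<tau> where \<tau>: "\<tau> \<in> K" "\<sigma> \<subseteq> \<tau>" "simplex_dim \<tau> = n"
    using assms by (auto simp: principal_complex_def)
  moreover have "finite \<tau>"
  proof -
    have "simplicial_complex K"
      using assms(1) by (simp add: principal_complex_def)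
    then show ?thesis
      using \<tau>(1) by (simp add: simplicial_complex_def)
  qed
  ultimately show ?thesis
    using card_mono[of \<tau> \<sigma>] by (simp add: simplex_dim_def)
qed

lemma card_selected_dimensions:
  assumes "\<pi> permutes {0..n}" "- 1 \<le> i"
  shows "finite (\<pi> ` {j. int j \<le> i})" "int (card (\<pi> ` {j. int j \<le> i})) = i + 1"
proof -
  have eq: "{j. int j \<le> i} = {..<nat (i + 1)}"
    using assms(2) by auto
  show "finite (\<pi> ` {j. int j \<le> i})" "int (card (\<pi> ` {j. int j \<le> i})) = i + 1"
    using assms(2) card_image[OF inj_on_subset[OF permutes_inj[OF assms(1)] subset_UNIV]]
    by (simp_all add: eq)
qed

lemma perm_complex_eq: "perm_complex K \<pi> i = {c \<in> derived K. simplex_dim ` c \<subseteq> \<pi> ` {j. int j \<le> i}}"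
  by (auto simp: perm_complex_def)

lemma acyclic_perm_space:
  assumes K: "principal_complex n K" and \<pi>: "\<pi> permutes {0..n}" and p: "i < p"
  shows "acyclic_pair p (perm_space K \<pi> i) {}"
proof (cases "i < 0")
  case True
  then show ?thesis
    by (simp add: perm_space_neg acyclic_pair_empty)
next
  case False
  let ?L = "perm_complex K \<pi> i"
  have K': "simplicial_complex K" "locally_finite K"
    using K by (auto simp: principal_complex_def)
  have card: "finite (\<pi> ` {j. int j \<le> i})" "int (card (\<pi> ` {j. int j \<le> i})) = i + 1"
    using card_selected_dimensions[OF \<pi>] False by auto
  have "simplicial_complex ?L"
    using simplicial_complex_derived[of K] unfolding perm_complex_eq simplicial_complex_def by blast
  then interpret balanced_complex ?L simplex_dim "\<pi> ` {j. int j \<le> i}"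
    by (intro balanced_derived[OF K'(1) card(1)]) (auto simp: perm_complex_eq)
  have "acyclic_pair p (cone_space ?L) (cone_space {})"
    using acyclic_above_dimension[of p] card p by (simp add: cone_space_def)
  from acyclic_pair_derived_space[OF K' _ _ this] show ?thesis
    by (simp add: perm_space_def perm_complex_eq derived_space_def realization_def)
qed

lemma acyclic_realization_perm_space:
  assumes K: "principal_complex n K" and \<pi>: "\<pi> permutes {0..n}" and p: "p \<le> i"
    and loc: "\<And>q x. q < int n \<Longrightarrow> x \<in> realization K \<Longrightarrow> acyclic_pair q (realization K) (realization K - {x})"
  shows "acyclic_pair p (realization K) (perm_space K \<pi> i)"
proof -
  have K': "simplicial_complex K" "locally_finite K"
    using K by (auto simp: principal_complex_def)
  consider "i < 0" | "int n \<le> i" | "0 \<le> i" "i < int n" by linarith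
  then show ?thesis
  proof cases
    case 1
    then show ?thesis using p by (simp add: acyclic_pair_neg)
  next
    case 2
    then show ?thesis
      using perm_complex_ge[OF K \<pi>] derived_space_derived[OF K']
      by (simp add: perm_space_def acyclic_pair_self)
  next
    case 3
    let ?S = "\<pi> ` {j. int j \<le> i}"
    interpret balanced_complex "derived K" simplex_dim "{0..n}"
      by (intro balanced_derived[OF K'(1)] simplicial_complex_derived)
        (use simplex_dim_le[OF K] in \<open>auto simp: derived_def\<close>)
    have "acyclic_pair p (cone_space (derived K)) (cone_space (perm_complex K \<pi> i))"
      unfolding perm_complex_eq
    proof (rule acyclic_colour_selection)
      show "acyclic_pair q C (C - ray (derived K) \<sigma>)" if "\<sigma> \<in> derived K" "q < int (card {0..n}) - 1" for \<sigma> q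
        using that by (intro acyclic_ray_complement[OF K' that(1)] loc) auto
      show "?S \<subseteq> {0..n}"
        using 3 permutes_in_image[OF \<pi>] by fastforce
      show "p < int (card ?S)"
        using card_selected_dimensions(2)[OF \<pi>, of i] 3 p by simp
    qed
    from acyclic_pair_derived_space[OF K' _ _ this] show ?thesis
      by (simp add: perm_space_def derived_space_derived[OF K'] perm_complex_eq)
  qed
qed

section \<open>Local homology of manifolds\<close>

lemma closed_singleton_fun: "closed {x :: 'v \<Rightarrow> real}"
proof -
  have "closed {u :: 'v \<Rightarrow> real. \<forall>v. u v = x v}"
    by (intro closed_Collect_all closed_Collect_eq continuous_on_const continuous_on_product_coordinates)
  moreover have "{u :: 'v \<Rightarrow> real. \<forall>v. u v = x v} = {x}"
    by (auto simp: fun_eq_iff)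
  ultimately show ?thesis by simp
qed

lemma acyclic_pair_local:
  fixes X :: "('v \<Rightarrow> real) set"
  assumes U: "openin (top_of_set X) U" and x: "x \<in> U"
  shows "acyclic_pair p X (X - {x}) \<longleftrightarrow> acyclic_pair p U (U - {x})"
proof -
  have UX: "U \<subseteq> X"
    using U openin_subset by fastforce
  have eq: "(X - {x}) \<union> U = X" "(X - {x}) \<inter> U = U - {x}"
    using x UX by auto
  have "openin (top_of_set X) (X - {x})"
    using closed_singleton_fun[of x] by (simp add: Diff_eq openin_open_Int open_Compl)
  then have "acyclic_pair p ((X - {x}) \<union> U) (X - {x}) \<longleftrightarrow> acyclic_pair p U ((X - {x}) \<inter> U)"
    by (intro acyclic_pair_excision) (simp_all only: eq U)
  then show ?thesis by (simp add: eq)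
qed

lemma half_space_eq: "half_space m = {y. (\<forall>i\<ge>m. y i = 0) \<and> 0 \<le> y 0}"
  by (auto simp: half_space_def topspace_Euclidean_space)

text \<open>
  Suspension along a coordinate parallel to the bounding hyperplane.
\<close>

lemma acyclic_half_space_step:
  fixes y :: "nat \<Rightarrow> real"
  assumes k: "0 < k" "k < m" "k \<notin> J"
  shows "acyclic_pair (p + 1) (half_space m) (half_space m - {z \<in> half_space m. \<forall>i\<in>insert k J. z i = y i})
    \<longleftrightarrow> acyclic_pair p (half_space m) (half_space m - {z \<in> half_space m. \<forall>i\<in>J. z i = y i})"
proof -
  let ?H = "half_space m" and ?P = "{z \<in> half_space m. \<forall>i\<in>J. z i = y i}"
  define push where "push = (\<lambda>s (t :: real, z :: nat \<Rightarrow> real). z(k := z k + s * t * (\<bar>z k - y k\<bar> + 1)))"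
  have push_cont: "continuous_on ({0..1} \<times> ?H) (push s)" for s
  proof -
    have coord: "continuous_on ({0..1::real} \<times> ?H) (\<lambda>x. snd x v)" for v
      by (intro continuous_on_product_then_coordinatewise[OF continuous_on_snd] continuous_on_id)
    show ?thesis
      unfolding push_def case_prod_beta
    proof (rule continuous_on_coordinatewise_then_product)
      show "continuous_on ({0..1} \<times> ?H) (\<lambda>x. ((snd x)(k := snd x k + s * fst x * (\<bar>snd x k - y k\<bar> + 1))) v)" for v
        using coord by (cases "v = k") (auto intro!: continuous_intros)
    qed
  qed
  have push: "push s (t, z) \<in> ?H \<and> (push s (t, z) \<in> ?P \<longleftrightarrow> z \<in> ?P)" if "z \<in> ?H" for s t z
    using that k by (auto simp: push_def half_space_eq)
  have cl: "closed {z :: nat \<Rightarrow> real. \<forall>i. i \<in> J \<longrightarrow> z i = y i}"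
    by (intro closed_Collect_all closed_Collect_imp open_Collect_const closed_Collect_eq
        continuous_on_const continuous_on_product_coordinates)
  have "acyclic_pair (p + 1) ?H (?H - {z \<in> ?P. z k - y k = 0}) \<longleftrightarrow> acyclic_pair p ?H (?H - ?P)"
  proof (rule acyclic_pair_suspension[where h = "push 1" and k = "push (- 1)"])
    show "closedin (top_of_set ?H) ?P"
      using closedin_closed_Int[OF cl, of ?H] by (simp add: Int_def Ball_def)
    show "continuous_on ?H (\<lambda>z. z k - y k)"
      by (intro continuous_intros continuous_on_subset[OF continuous_on_product_coordinates subset_UNIV])
    show "push 1 (t, z) \<in> ?H \<and> (push 1 (t, z) \<in> ?P \<longleftrightarrow> z \<in> ?P) \<and> z k - y k \<le> push 1 (t, z) k - y k"
      if "t \<in> {0..1}" "z \<in> ?H" for t z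
    proof (intro conjI)
      show "z k - y k \<le> push 1 (t, z) k - y k"
        using that(1) by (simp add: push_def)
    qed (use push[OF that(2), of 1 t] in blast)+
    show "push (- 1) (t, z) \<in> ?H \<and> (push (- 1) (t, z) \<in> ?P \<longleftrightarrow> z \<in> ?P) \<and> push (- 1) (t, z) k - y k \<le> z k - y k"
      if "t \<in> {0..1}" "z \<in> ?H" for t z
    proof (intro conjI)
      show "push (- 1) (t, z) k - y k \<le> z k - y k"
        using that(1) by (simp add: push_def)
    qed (use push[OF that(2), of "- 1" t] in blast)+
    show "continuous_on ({0..1} \<times> ?H) (push 1)" "continuous_on ({0..1} \<times> ?H) (push (- 1))"
      by (rule push_cont)+
  qed (auto simp: push_def)
  moreover have "{z \<in> ?P. z k - y k = 0} = {z \<in> ?H. \<forall>i\<in>insert k J. z i = y i}"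
    by auto
  ultimately show ?thesis by simp
qed

text \<open>
  The \<open>m - 1\<close> coordinates parallel to the bounding hyperplane are removed by suspension, which treats interior
  and boundary points alike. What remains is the set \<open>z 0 = y 0\<close> in degrees at most 0. Its complement
  is not empty and the half-space is contractible, so the relative group of degree 0 vanishes.
\<close>

lemma acyclic_half_space:
  assumes y: "y \<in> half_space m" and p: "p < int m"
  shows "acyclic_pair p (half_space m) (half_space m - {y})"
proof (cases "m = 0")
  case True
  then show ?thesis using p by (simp add: acyclic_pair_neg)
next
  case False
  let ?H = "half_space m" and ?P = "\<lambda>J. {z \<in> half_space m. \<forall>i\<in>J. z i = y i}"
  define q where "q = p - int (m - 1)"
  have q: "q \<le> 0"
    using p False by (simp add: q_def)
  have base: "acyclic_pair q ?H (?H - ?P {0})"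
  proof (cases "q < 0")
    case True
    then show ?thesis by (simp add: acyclic_pair_neg)
  next
    case q0: False
    define a where "a = y(0 := y 0 + 1)"
    have a: "a \<in> ?H" "a \<notin> ?P {0}"
      using y False by (auto simp: a_def half_space_eq)
    have "acyclic_pair q ?H {a}"
    proof (rule acyclic_pair_deformation[where h = "\<lambda>(t, z). affine_comb t z a"])
      show "continuous_on ({0..1} \<times> ?H) (\<lambda>(t, z). affine_comb t z a)"
        unfolding affine_comb_def case_prod_beta
        by (intro continuous_on_coordinatewise_then_product continuous_intros
            continuous_on_product_then_coordinatewise[OF continuous_on_snd] continuous_on_id)
      show "(\<lambda>(t, z). affine_comb t z a) (t, z) \<in> ?H" if "t \<in> {0..1}" "z \<in> ?H" for t z
        using that a by (auto simp: half_space_eq affine_comb_def)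
      show "(\<lambda>(t, z). affine_comb t z a) (t, z) \<in> {a}" if "t \<in> {0..1}" "z \<in> {a}" for t z
        using that by (auto simp: affine_comb_def fun_eq_iff algebra_simps)
    qed (use a in \<open>auto simp: affine_comb_def\<close>)
    then show ?thesis
      by (rule acyclic_pair_quotient[rotated 2]) (use a q in \<open>auto simp: acyclic_pair_neg\<close>)
  qed
  have "acyclic_pair (q + int (card F)) ?H (?H - ?P (insert 0 F)) \<longleftrightarrow> acyclic_pair q ?H (?H - ?P {0})"
    if "finite F" "F \<subseteq> {1..<m}" for F
    using that
  proof (induction F)
    case (insert k F)
    then have "0 < k" "k < m" "k \<notin> insert 0 F" by auto
    from acyclic_half_space_step[OF this, of "q + int (card F)" y] show ?case
      using insert by (simp add: insert_commute[of k] algebra_simps del: ball_simps)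
  qed simp
  from this[of "{1..<m}"] base have "acyclic_pair p ?H (?H - ?P (insert 0 {1..<m}))"
    by (simp add: q_def)
  moreover have "?P (insert 0 {1..<m}) = {y}"
  proof -
    have "z = y" if "z \<in> ?P (insert 0 {1..<m})" for z
    proof
      fix i show "z i = y i"
        using that y by (cases "i = 0"; cases "i < m") (auto simp: half_space_eq)
    qed
    then show ?thesis using y by auto
  qed
  ultimately show ?thesis by simp
qed

lemma Euclidean_space_eq_top_of_set: "Euclidean_space n = top_of_set {y. \<forall>i\<ge>n. y i = 0}"
  by (simp add: Euclidean_space_def euclidean_product_topology)

lemma not_openin_lower_dimension:
  assumes "m < n" "openin (Euclidean_space n) S" "\<And>y. y \<in> S \<Longrightarrow> y m = 0"
  shows "S = {}"
proof (rule ccontr)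
  assume "S \<noteq> {}"
  then obtain z where z: "z \<in> S" by blast
  let ?E = "{y :: nat \<Rightarrow> real. \<forall>i\<ge>n. y i = 0}"
  obtain O' where O': "open O'" "S = ?E \<inter> O'"
    using assms(2) unfolding Euclidean_space_eq_top_of_set by (auto simp: openin_open)
  \<comment> \<open>a line that leaves the hyperplane at once, although it starts in an open set contained in it\<close>
  define l where "l = (\<lambda>s. z(m := s))"
  have "continuous_on UNIV l"
  proof (rule continuous_on_coordinatewise_then_product)
    show "continuous_on UNIV (\<lambda>s. l s v)" for v
      by (cases "v = m") (auto simp: l_def)
  qed
  then have "open (l -` O')"
    using O'(1) by (metis continuous_on_open_vimage[OF open_UNIV] inf_top.right_neutral)
  moreover have "l -` O' = {0}"
  proof
    show "{0} \<subseteq> l -` O'"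
      using z assms(3)[OF z] O' by (auto simp: l_def fun_upd_idem)
    show "l -` O' \<subseteq> {0}"
    proof
      fix s assume "s \<in> l -` O'"
      moreover have "l s \<in> ?E"
        using z O'(2) assms(1) by (auto simp: l_def)
      ultimately have "l s \<in> S" using O'(2) by simp
      then show "s \<in> {0}" using assms(3) by (force simp: l_def)
    qed
  qed
  ultimately show False
    by (simp add: not_open_singleton)
qed

text \<open>
  The affine chart of an open \<open>n\<close>-simplex: the first \<open>n\<close> vertices carry the coordinates and the last one
  the remaining mass.
\<close>

lemma simplex_chart:
  assumes K: "simplicial_complex K" and \<tau>: "\<tau> \<in> K" "simplex_dim \<tau> = n"
  obtains e :: "(nat \<Rightarrow> real) \<Rightarrow> 'v \<Rightarrow> real" and Q where
    "openin (Euclidean_space n) Q" "Q \<noteq> {}" "continuous_on Q e" "inj_on e Q" "e ` Q \<subseteq> realization K"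
proof -
  let ?E = "{y :: nat \<Rightarrow> real. \<forall>i\<ge>n. y i = 0}"
  have fin: "finite \<tau>" "\<tau> \<noteq> {}"
    using \<tau>(1) K by (auto simp: simplicial_complex_def)
  then have card: "card \<tau> = Suc n"
    using \<tau>(2) Suc_diff_1[of "card \<tau>"] by (simp add: simplex_dim_def card_gt_0_iff)
  obtain w where w: "bij_betw w {0..<Suc n} \<tau>"
    using ex_bij_betw_nat_finite[OF fin(1)] card by auto
  define idx where "idx = inv_into {0..<Suc n} w"
  have idx: "idx (w i) = i" if "i \<le> n" for i
    using that w by (simp add: idx_def bij_betw_def)
  have w_in: "w i \<in> \<tau>" if "i \<le> n" for i
    using that w by (auto simp: bij_betw_def)
  define Q where "Q = {y \<in> ?E. (\<forall>i\<in>{..<n}. 0 < y i) \<and> (\<Sum>i<n. y i) < 1}"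
  define e where "e = (\<lambda>y v. if v \<in> \<tau> then if idx v < n then y (idx v) else 1 - (\<Sum>i<n. y i) else 0 :: real)"
  have "open ((\<Inter>i\<in>{..<n}. {y :: nat \<Rightarrow> real. 0 < y i}) \<inter> {y. (\<Sum>i<n. y i) < 1})"
    by (intro open_Int open_INT ballI open_Collect_less continuous_intros
        continuous_on_product_coordinates) simp
  note op = openin_open_Int[OF this, of ?E]
  have Q_eq: "?E \<inter> ((\<Inter>i\<in>{..<n}. {y :: nat \<Rightarrow> real. 0 < y i}) \<inter> {y. (\<Sum>i<n. y i) < 1}) = Q"
    by (auto simp: Q_def)
  have opQ: "openin (Euclidean_space n) Q"
    using op unfolding Euclidean_space_eq_top_of_set Q_eq .
  have "(\<lambda>i. if i < n then 1 / real (Suc n) else 0) \<in> Q"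
    by (auto simp: Q_def field_simps)
  then have ne: "Q \<noteq> {}" by blast
  have cont: "continuous_on Q e"
    unfolding e_def
  proof (rule continuous_on_coordinatewise_then_product)
    have coord: "continuous_on Q (\<lambda>y. y v)" for v
      by (rule continuous_on_subset[OF continuous_on_product_coordinates subset_UNIV])
    show "continuous_on Q (\<lambda>y. if v \<in> \<tau> then if idx v < n then y (idx v) else 1 - (\<Sum>i<n. y i) else 0)" for v
      by (cases "v \<in> \<tau>"; cases "idx v < n") (auto intro!: continuous_intros coord)
  qed
  have ew: "e y (w i) = y i" if "i < n" for y i
    using that idx[of i] w_in[of i] by (simp add: e_def)
  have ewn: "e y (w n) = 1 - (\<Sum>i<n. y i)" for y
    using idx[of n] w_in[of n] by (simp add: e_def)
  have inj: "inj_on e Q"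
  proof (rule inj_onI)
    fix y z assume yz: "y \<in> Q" "z \<in> Q" "e y = e z"
    show "y = z"
    proof
      fix i show "y i = z i"
        using yz ew[of i y] ew[of i z] by (cases "i < n") (auto simp: Q_def)
    qed
  qed
  have "e y \<in> realization K" if y: "y \<in> Q" for y
  proof -
    have pos: "e y (w i) > 0" if "i \<le> n" for i
      using y that ew[of i y] ewn[of y] by (cases "i < n") (auto simp: Q_def)
    have \<tau>_eq: "\<tau> = w ` {0..<Suc n}"
      using w by (simp add: bij_betw_def)
    have pos': "e y v > 0" if "v \<in> \<tau>" for v
      using that pos unfolding \<tau>_eq by auto
    then have supp: "supp (e y) = \<tau>"
      by (auto simp: supp_def e_def less_imp_neq[symmetric] split: if_splits)
    have "(\<Sum>v\<in>\<tau>. e y v) = (\<Sum>i\<in>{0..<Suc n}. e y (w i))"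
      using sum.reindex_bij_betw[OF w, of "e y"] by simp
    also have "\<dots> = 1"
      using ew ewn by (simp add: lessThan_atLeast0)
    finally have "(\<Sum>v\<in>supp (e y). e y v) = 1"
      by (simp add: supp)
    moreover have "0 \<le> e y v" for v
      using pos'[of v] by (cases "v \<in> \<tau>") (auto simp: e_def)
    ultimately show ?thesis
      using \<tau>(1) by (simp add: realization_def supp)
  qed
  then have "e ` Q \<subseteq> realization K" by blast
  with opQ ne cont inj show ?thesis
    by (rule that)
qed

text \<open>
  If \<open>m < n\<close>, composing an affine chart of an \<open>n\<close>-simplex with a chart of the manifold gives an injective
  continuous map from an open subset of \<open>\<real>\<^sup>n\<close> into a proper coordinate subspace, against invariance of domain.
\<close>

lemma dimension_le_of_charts:
  assumes K: "simplicial_complex K" and \<tau>: "\<tau> \<in> K" "simplex_dim \<tau> = n"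
    and charts: "\<And>x. x \<in> realization K \<Longrightarrow> \<exists>U V f g. openin (top_of_set (realization K)) U \<and> x \<in> U
      \<and> homeomorphism U V f g \<and> V \<subseteq> half_space m"
  shows "n \<le> m"
proof (rule ccontr)
  assume "\<not> n \<le> m"
  then have mn: "m < n" by simp
  obtain e :: "(nat \<Rightarrow> real) \<Rightarrow> 'a \<Rightarrow> real" and Q where
    e: "openin (Euclidean_space n) Q" "Q \<noteq> {}" "continuous_on Q e" "inj_on e Q" "e ` Q \<subseteq> realization K"
    by (rule simplex_chart[OF K \<tau>])
  then obtain y0 where y0: "y0 \<in> Q" by blast
  then obtain U V f g where U: "openin (top_of_set (realization K)) U" "e y0 \<in> U"
    and f: "homeomorphism U V f g" "V \<subseteq> half_space m"
    using charts[of "e y0"] e(5) by blast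
  define Q' where "Q' = Q \<inter> e -` U"
  have "openin (top_of_set Q) Q'"
    unfolding Q'_def by (rule continuous_openin_preimage[OF e(3) _ U(1)]) (use e(5) in auto)
  then have Q': "openin (Euclidean_space n) Q'"
    using openin_trans[OF _ e(1)[unfolded Euclidean_space_eq_top_of_set]] by (simp add: Euclidean_space_eq_top_of_set)
  have cont: "continuous_on Q' (f \<circ> e)"
    using e(3) f(1) by (intro continuous_on_compose) (auto simp: Q'_def homeomorphism_def intro: continuous_on_subset)
  have inj: "inj_on (f \<circ> e) Q'"
    using e(4) f(1) by (auto simp: Q'_def homeomorphism_def inj_on_def) metis
  have image: "(f \<circ> e) ` Q' \<subseteq> half_space m"
    using f by (auto simp: Q'_def homeomorphism_def)
  have "half_space m \<subseteq> {y. \<forall>i\<ge>n. y i = 0}"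
    using mn by (auto simp: half_space_eq)
  moreover have "Q' \<subseteq> {y. \<forall>i\<ge>n. y i = 0}"
    using Q' openin_subset unfolding Euclidean_space_eq_top_of_set by fastforce
  moreover from calculation(1) have "(f \<circ> e) ` Q' \<subseteq> {y. \<forall>i\<ge>n. y i = 0}"
    using image by (rule order_trans[rotated])
  ultimately have "continuous_map (subtopology (Euclidean_space n) Q') (Euclidean_space n) (f \<circ> e)"
    using cont unfolding Euclidean_space_eq_top_of_set
    by (simp add: subtopology_top_of_set image_subset_iff_funcset o_def)
  then have "openin (Euclidean_space n) ((f \<circ> e) ` Q')"
    by (rule invariance_of_domain_Euclidean_space[OF Q' _ inj])
  then have "(f \<circ> e) ` Q' = {}"
    by (rule not_openin_lower_dimension[OF mn]) (use image in \<open>auto simp: half_space_eq\<close>)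
  then show False
    using y0 U(2) by (auto simp: Q'_def)
qed

text \<open>
  The charts have some dimension \<open>m\<close>. Comparison with an \<open>n\<close>-simplex gives \<open>n \<le> m\<close>, and excision gives the local
  homology of the half-space, which vanishes below \<open>m\<close>.
\<close>

lemma manifold_locally_acyclic:
  assumes K: "principal_complex n K" and man: "PL_manifold (realization K)"
    and q: "q < int n" and x: "x \<in> realization K"
  shows "acyclic_pair q (realization K) (realization K - {x})"
proof -
  obtain m where m: "\<And>x. x \<in> realization K \<Longrightarrow> \<exists>U V. openin (top_of_set (realization K)) U \<and> x \<in> U \<and>
      openin (top_of_set (half_space m)) V \<and> PL_homeomorphic U V"
    using man unfolding PL_manifold_def by blast
  have charts: "\<exists>U V f g. openin (top_of_set (realization K)) U \<and> x \<in> U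
      \<and> homeomorphism U V f g \<and> openin (top_of_set (half_space m)) V" if "x \<in> realization K" for x
    using m[OF that] unfolding PL_homeomorphic_def by blast
  have K': "simplicial_complex K"
    using K by (simp add: principal_complex_def)
  obtain \<tau> where \<tau>: "\<tau> \<in> K" "simplex_dim \<tau> = n"
    using K x by (auto simp: principal_complex_def realization_def)
  have "n \<le> m"
  proof (rule dimension_le_of_charts[OF K' \<tau>])
    fix x assume "x \<in> realization K"
    from charts[OF this] show "\<exists>U V f g. openin (top_of_set (realization K)) U \<and> x \<in> U
      \<and> homeomorphism U V f g \<and> V \<subseteq> half_space m"
      by (metis openin_imp_subset)
  qed
  obtain U V f g where U: "openin (top_of_set (realization K)) U" "x \<in> U"
    and f: "homeomorphism U V f g" and V: "openin (top_of_set (half_space m)) V"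
    using charts[OF x] by blast
  have fx: "f x \<in> V"
    using f U(2) by (auto simp: homeomorphism_def)
  then have "f x \<in> half_space m"
    using V openin_imp_subset by blast
  then have "acyclic_pair q (half_space m) (half_space m - {f x})"
    using q \<open>n \<le> m\<close> by (intro acyclic_half_space) auto
  then have "acyclic_pair q V (V - {f x})"
    by (simp add: acyclic_pair_local[OF V fx])
  then have "acyclic_pair q U (U - {x})"
  proof (rule acyclic_pair_homeomorphic[OF _ _ f])
    have "inj_on f U" "f ` U = V"
      using f by (auto simp: homeomorphism_def intro: inj_on_inverseI)
    then show "f ` (U - {x}) = V - {f x}"
      using U(2) by (simp add: inj_on_image_set_diff)
  qed auto
  then show ?thesis
    by (simp add: acyclic_pair_local[OF U])
qed

section \<open>Permutation homology\<close>

text \<open>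
  Identify \<open>H\<close> with its image \<open>Z\<close>. The quotient by \<open>B\<close> becomes \<open>H\<close> modulo the kernel of \<open>e\<close>, and the map
  becomes the one of the first isomorphism theorem.
\<close>

lemma quotient_along_injection_iso:
  assumes H: "group H" and G: "group G" and Q: "group Q"
    and r: "r \<in> hom H G" "inj_on r (carrier H)"
    and e: "e \<in> hom H Q" "e ` carrier H = carrier Q"
    and Z: "Z = r ` carrier H" and B: "B = r ` kernel H Q e"
  shows "(\<lambda>X. THE y. \<exists>z\<in>carrier H. r z \<in> X \<and> y = e z) \<in> iso (G\<lparr>carrier := Z\<rparr> Mod B) Q"
proof -
  interpret H: group H by fact
  define \<psi> where "\<psi> = e \<circ> inv_into (carrier H) r"
  have \<psi>: "\<psi> (r z) = e z" if "z \<in> carrier H" for z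
    using that r(2) by (simp add: \<psi>_def)
  interpret rh: group_hom H G r
    using H G r(1) by (simp add: group_hom_def group_hom_axioms_def)
  let ?G = "G\<lparr>carrier := Z\<rparr>"
  have G': "group ?G"
    unfolding Z by (rule subgroup.subgroup_is_group[OF rh.img_is_subgroup G])
  have "\<psi> \<in> hom ?G Q"
  proof (rule homI)
    show "\<psi> x \<in> carrier Q" if "x \<in> carrier ?G" for x
      using that \<psi> e(1) by (auto simp: Z hom_def)
    show "\<psi> (x \<otimes>\<^bsub>?G\<^esub> y) = \<psi> x \<otimes>\<^bsub>Q\<^esub> \<psi> y" if xy: "x \<in> carrier ?G" "y \<in> carrier ?G" for x y
    proof -
      obtain a b where ab: "a \<in> carrier H" "b \<in> carrier H" "x = r a" "y = r b"
        using xy by (auto simp: Z)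
      then have "x \<otimes>\<^bsub>?G\<^esub> y = r (a \<otimes>\<^bsub>H\<^esub> b)"
        by simp
      then have "\<psi> (x \<otimes>\<^bsub>?G\<^esub> y) = e (a \<otimes>\<^bsub>H\<^esub> b)"
        using \<psi>[OF H.m_closed[OF ab(1,2)]] by (simp only:)
      then show ?thesis
        using ab \<psi> hom_mult[OF e(1)] by simp
    qed
  qed
  then have hom: "group_hom ?G Q \<psi>"
    using G' Q by (simp add: group_hom_def group_hom_axioms_def)
  have onto: "\<psi> ` carrier ?G = carrier Q"
    using \<psi> e(2) by (force simp: Z image_image)
  have ker: "kernel ?G Q \<psi> = B"
    using \<psi> by (force simp: kernel_def Z B)
  have iso: "(\<lambda>X. the_elem (\<psi> ` X)) \<in> iso (?G Mod B) Q"
    using group_hom.FactGroup_iso_set[OF hom onto] by (simp add: ker)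
  have eq: "(THE y. \<exists>z\<in>carrier H. r z \<in> X \<and> y = e z) = the_elem (\<psi> ` X)" if X: "X \<in> carrier (?G Mod B)" for X
  proof -
    obtain g where g: "g \<in> carrier ?G" "X = kernel ?G Q \<psi> #>\<^bsub>?G\<^esub> g"
      using X by (auto simp: FactGroup_def RCOSETS_def ker)
    have XZ: "X \<subseteq> Z"
      using g monoid.r_coset_subset_G[OF group.is_monoid[OF G'], of "kernel ?G Q \<psi>" g] by (auto simp: kernel_def)
    have "\<psi> x = \<psi> g" if "x \<in> X" for x
    proof -
      obtain k where k: "k \<in> kernel ?G Q \<psi>" "x = k \<otimes>\<^bsub>?G\<^esub> g"
        using \<open>x \<in> X\<close> g(2) by (auto simp: r_coset_def)
      then have "\<psi> x = \<psi> k \<otimes>\<^bsub>Q\<^esub> \<psi> g"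
        using g(1) group_hom.hom_mult[OF hom] by (simp add: kernel_def)
      also have "\<dots> = \<psi> g"
        using k g(1) group_hom.hom_closed[OF hom] Q by (simp add: kernel_def group.is_monoid)
      finally show ?thesis .
    qed
    moreover have "g \<in> X"
      using g group_hom.subgroup_kernel[OF hom] group.rcos_self[OF G'] by blast
    ultimately have image: "\<psi> ` X = {\<psi> g}" by blast
    have "(\<exists>z\<in>carrier H. r z \<in> X \<and> y = e z) \<longleftrightarrow> y \<in> \<psi> ` X" for y
    proof
      assume "\<exists>z\<in>carrier H. r z \<in> X \<and> y = e z"
      then show "y \<in> \<psi> ` X" using \<psi> by force
    next
      assume "y \<in> \<psi> ` X"
      then obtain x where "x \<in> X" "y = \<psi> x" by blast
      moreover then obtain z where "z \<in> carrier H" "x = r z"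
        using XZ Z by blast
      ultimately show "\<exists>z\<in>carrier H. r z \<in> X \<and> y = e z"
        using \<psi> by blast
    qed
    then show ?thesis
      by (simp add: image)
  qed
  let ?\<phi> = "\<lambda>X. THE y. \<exists>z\<in>carrier H. r z \<in> X \<and> y = e z"
  interpret F: group "?G Mod B"
    using group_hom.normal_kernel[OF hom] by (simp add: ker normal.factorgroup_is_group)
  show ?thesis
  proof (rule isoI)
    show "?\<phi> \<in> hom (?G Mod B) Q"
    proof (rule homI)
      show "?\<phi> X \<in> carrier Q" if "X \<in> carrier (?G Mod B)" for X
        using iso that by (simp add: eq[OF that] iso_def hom_def Pi_iff)
      show "?\<phi> (X \<otimes>\<^bsub>?G Mod B\<^esub> Y) = ?\<phi> X \<otimes>\<^bsub>Q\<^esub> ?\<phi> Y"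
        if "X \<in> carrier (?G Mod B)" "Y \<in> carrier (?G Mod B)" for X Y
        unfolding eq[OF F.m_closed[OF that]] eq[OF that(1)] eq[OF that(2)]
        using iso that by (simp add: iso_def hom_def)
    qed
    show "bij_betw ?\<phi> (carrier (?G Mod B)) (carrier Q)"
    proof -
      have "bij_betw ?\<phi> (carrier (?G Mod B)) (carrier Q)
          \<longleftrightarrow> bij_betw (\<lambda>X. the_elem (\<psi> ` X)) (carrier (?G Mod B)) (carrier Q)"
        by (rule bij_betw_cong) (rule eq)
      then show ?thesis
        using iso by (simp add: iso_def)
    qed
  qed
qed

text \<open>
  The kernel is the image of \<open>H\<^sub>p(X \<inter> S) = 0\<close>.
\<close>

lemma hom_induced_absolute_inj:
  assumes "acyclic_pair p (X \<inter> S) {}"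
  shows "inj_on (hom_induced p (top_of_set X) {} (top_of_set X) S id) (carrier (homology_group p (top_of_set X)))"
proof -
  let ?i = "hom_induced p (top_of_set (X \<inter> S)) {} (top_of_set X) {} id"
  let ?j = "hom_induced p (top_of_set X) {} (top_of_set X) S id"
  have sub: "subtopology (top_of_set X) S = top_of_set (X \<inter> S)"
    by (simp add: subtopology_subtopology)
  have "group_hom (homology_group p (top_of_set (X \<inter> S))) (homology_group p (top_of_set X)) ?i"
    and j: "group_hom (homology_group p (top_of_set X)) (relative_homology_group p (top_of_set X) S) ?j"
    by (simp_all add: group_hom_def group_hom_axioms_def hom_induced_hom)
  then have "?i ` carrier (homology_group p (top_of_set (X \<inter> S))) = {\<one>\<^bsub>homology_group p (top_of_set X)\<^esub>}"
    using assms by (intro group_hom.image_from_trivial_group) (auto simp: acyclic_pair_def)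
  then have "kernel (homology_group p (top_of_set X)) (relative_homology_group p (top_of_set X) S) ?j
      = {\<one>\<^bsub>homology_group p (top_of_set X)\<^esub>}"
    using homology_exactness_axiom_3[of p "top_of_set X" S] by (simp add: sub)
  then show ?thesis
    using group_hom.inj_iff_trivial_ker[OF j] by simp
qed

lemma hom_induced_inclusion_onto:
  assumes "S \<subseteq> X" "acyclic_pair p X S"
  shows "hom_induced p (top_of_set S) {} (top_of_set X) {} id ` carrier (homology_group p (top_of_set S))
    = carrier (homology_group p (top_of_set X))"
proof -
  let ?j = "hom_induced p (top_of_set X) {} (top_of_set X) S id"
  have j: "group_hom (homology_group p (top_of_set X)) (relative_homology_group p (top_of_set X) S) ?j"
    by (simp add: group_hom_def group_hom_axioms_def hom_induced_hom)
  then have "kernel (homology_group p (top_of_set X)) (relative_homology_group p (top_of_set X) S) ?j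
      = carrier (homology_group p (top_of_set X))"
    using assms(2) by (intro group_hom.kernel_to_trivial_group) (auto simp: acyclic_pair_def)
  then show ?thesis
    using homology_exactness_axiom_3[of p "top_of_set X" S] assms(1) by (simp add: subtopology_top_of_set)
qed

lemma hom_induced_inclusion_inj:
  assumes "S \<subseteq> X" "acyclic_pair (p + 1) X S"
  shows "inj_on (hom_induced p (top_of_set S) {} (top_of_set X) {} id) (carrier (homology_group p (top_of_set S)))"
proof -
  let ?i = "hom_induced p (top_of_set S) {} (top_of_set X) {} id"
  let ?b = "hom_boundary (p + 1) (top_of_set X) S"
  have i: "group_hom (homology_group p (top_of_set S)) (homology_group p (top_of_set X)) ?i"
    by (simp add: group_hom_def group_hom_axioms_def hom_induced_hom)
  have "group_hom (relative_homology_group (p + 1) (top_of_set X) S) (homology_group p (top_of_set S)) ?b"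
    using hom_boundary_hom[of "p + 1" "top_of_set X" S] assms(1)
    by (simp add: group_hom_def group_hom_axioms_def subtopology_top_of_set)
  then have "?b ` carrier (relative_homology_group (p + 1) (top_of_set X) S) = {\<one>\<^bsub>homology_group p (top_of_set S)\<^esub>}"
    using assms(2) by (intro group_hom.image_from_trivial_group) (auto simp: acyclic_pair_def)
  then have "kernel (homology_group p (top_of_set S)) (homology_group p (top_of_set X)) ?i
      = {\<one>\<^bsub>homology_group p (top_of_set S)\<^esub>}"
    using homology_exactness_axiom_2[of "p + 1" "top_of_set X" S] assms(1) by (simp add: subtopology_top_of_set)
  then show ?thesis
    using group_hom.inj_iff_trivial_ker[OF i] by simp
qed

text \<open>
  The two vanishing hypotheses are the dimension bound and the connectivity statement. The map \<open>r j\<close>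
  sends absolute to relative classes, and the boundary operator of the permutation chain complex is \<open>r (j - 1)\<close>
  after the connecting map \<open>\<beta> j\<close>.
\<close>

lemma natural_map_iso:
  assumes sub: "\<And>j. perm_space K \<pi> j \<subseteq> realization K"
    and above: "\<And>j p. j < p \<Longrightarrow> acyclic_pair p (perm_space K \<pi> j) {}"
    and below: "\<And>j p. p \<le> j \<Longrightarrow> acyclic_pair p (realization K) (perm_space K \<pi> j)"
  shows "natural_map K \<pi> i \<in> iso (perm_homology_group K \<pi> i) (homology_group i (top_of_set (realization K)))"
proof -
  define T where "T j = top_of_set (perm_space K \<pi> j)" for j
  define r where "r j = hom_induced j (T j) {} (T j) (perm_space K \<pi> (j - 1)) id" for j
  define \<beta> where "\<beta> j = hom_boundary j (T j) (perm_space K \<pi> (j - 1))" for j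
  let ?R = "top_of_set (realization K)"
  define e where "e = hom_induced i (T i) {} ?R {} id"
  have subT: "subtopology (T j) (perm_space K \<pi> (j - 1)) = T (j - 1)" for j
    using perm_space_mono[of "j - 1" j K \<pi>] by (simp add: T_def subtopology_top_of_set)
  have chain_group: "perm_chain_group K \<pi> j = relative_homology_group j (T j) (perm_space K \<pi> (j - 1))" for j
    by (simp add: perm_chain_group_def T_def)
  have r_hom: "r j \<in> hom (homology_group j (T j)) (perm_chain_group K \<pi> j)" for j
    by (simp add: r_def perm_chain_group_def T_def hom_induced_hom)
  have r_inj: "inj_on (r j) (carrier (homology_group j (T j)))" for j
  proof -
    have "perm_space K \<pi> j \<inter> perm_space K \<pi> (j - 1) = perm_space K \<pi> (j - 1)"
      using perm_space_mono[of "j - 1" j K \<pi>] by auto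
    then show ?thesis
      unfolding r_def T_def using above by (intro hom_induced_absolute_inj) simp
  qed
  have \<beta>_in: "\<beta> j x \<in> carrier (homology_group (j - 1) (T (j - 1)))" for j x
    using hom_boundary_carrier[of j "T j" "perm_space K \<pi> (j - 1)" x] by (simp add: \<beta>_def subT)
  have boundary: "perm_boundary K \<pi> j = r (j - 1) \<circ> \<beta> j" for j
    unfolding perm_boundary_def hom_relboundary_def r_def \<beta>_def T_def[symmetric] subT
    by simp
  have cycles: "perm_cycles K \<pi> i = r i ` carrier (homology_group i (T i))"
  proof -
    have "\<one>\<^bsub>perm_chain_group K \<pi> (i - 1)\<^esub> = r (i - 1) \<one>\<^bsub>homology_group (i - 1) (T (i - 1))\<^esub>"
      using hom_one[OF r_hom] by (simp add: perm_chain_group_def)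
    then have "perm_boundary K \<pi> i x = \<one>\<^bsub>perm_chain_group K \<pi> (i - 1)\<^esub>
        \<longleftrightarrow> \<beta> i x = \<one>\<^bsub>homology_group (i - 1) (T (i - 1))\<^esub>" for x
      using inj_on_eq_iff[OF r_inj[of "i - 1"] \<beta>_in[of i x], of "\<one>\<^bsub>homology_group (i - 1) (T (i - 1))\<^esub>"]
      by (simp add: boundary group.is_monoid)
    then have "perm_cycles K \<pi> i = kernel (perm_chain_group K \<pi> i) (homology_group (i - 1) (T (i - 1))) (\<beta> i)"
      by (simp add: perm_cycles_def kernel_def)
    also have "\<dots> = r i ` carrier (homology_group i (T i))"
      using homology_exactness_axiom_1[of i "T i" "perm_space K \<pi> (i - 1)"]
      by (simp add: subT r_def \<beta>_def chain_group)
    finally show ?thesis .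
  qed
  have e_hom: "e \<in> hom (homology_group i (T i)) (homology_group i ?R)"
    by (simp add: e_def hom_induced_hom)
  have e_onto: "e ` carrier (homology_group i (T i)) = carrier (homology_group i ?R)"
    unfolding e_def T_def by (rule hom_induced_inclusion_onto) (use sub below in auto)
  have boundaries: "perm_boundaries K \<pi> i = r i ` kernel (homology_group i (T i)) (homology_group i ?R) e"
  proof -
    let ?k = "hom_induced i (T i) {} (T (i + 1)) {} id" and ?l = "hom_induced i (T (i + 1)) {} ?R {} id"
    have "continuous_map (T i) (T (i + 1)) id" "continuous_map (T (i + 1)) ?R id"
      using perm_space_mono[of i "i + 1" K \<pi>] sub[of "i + 1"] by (auto simp: T_def)
    then have comp: "e = ?l \<circ> ?k"
      using hom_induced_compose[of "T i" "T (i + 1)" id "{}" "{}" ?R id "{}" i] by (simp add: e_def)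
    have l_inj: "inj_on ?l (carrier (homology_group i (T (i + 1))))"
      unfolding T_def by (rule hom_induced_inclusion_inj) (use sub below in auto)
    have "?l \<one>\<^bsub>homology_group i (T (i + 1))\<^esub> = \<one>\<^bsub>homology_group i ?R\<^esub>"
      by (rule hom_one[OF hom_induced_hom]) simp_all
    then have "e x = \<one>\<^bsub>homology_group i ?R\<^esub> \<longleftrightarrow> ?k x = \<one>\<^bsub>homology_group i (T (i + 1))\<^esub>" for x
      using inj_on_eq_iff[OF l_inj, of "?k x" "\<one>\<^bsub>homology_group i (T (i + 1))\<^esub>"]
      by (simp add: comp hom_induced_carrier group.is_monoid)
    then have "kernel (homology_group i (T i)) (homology_group i ?R) e
        = kernel (homology_group i (T i)) (homology_group i (T (i + 1))) ?k"
      by (simp add: kernel_def)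
    also have "\<dots> = \<beta> (i + 1) ` carrier (perm_chain_group K \<pi> (i + 1))"
      using homology_exactness_axiom_2[of "i + 1" "T (i + 1)" "perm_space K \<pi> i"] subT[of "i + 1"]
      by (simp add: \<beta>_def chain_group)
    finally show ?thesis
      by (simp add: perm_boundaries_def boundary image_comp)
  qed
  have "natural_map K \<pi> i = (\<lambda>X. THE y. \<exists>z\<in>carrier (homology_group i (T i)). r i z \<in> X \<and> y = e z)"
    by (simp add: fun_eq_iff natural_map_def r_def e_def T_def)
  moreover have "(\<lambda>X. THE y. \<exists>z\<in>carrier (homology_group i (T i)). r i z \<in> X \<and> y = e z)
      \<in> iso ((perm_chain_group K \<pi> i)\<lparr>carrier := perm_cycles K \<pi> i\<rparr> Mod perm_boundaries K \<pi> i)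
        (homology_group i ?R)"
    by (rule quotient_along_injection_iso[OF _ _ _ r_hom r_inj e_hom e_onto cycles boundaries])
      (simp_all add: perm_chain_group_def)
  ultimately show ?thesis
    by (simp add: perm_homology_group_def)
qed

theorem proposition2p2:
  fixes K :: "'v set set" and n :: nat and \<pi> :: "nat \<Rightarrow> nat" and i :: nat
  assumes "principal_complex n K"
    and "\<pi> permutes {0..n}"
    and "PL_manifold (realization K)"
    and "i \<le> n"
  shows "natural_map K \<pi> (int i)
    \<in> iso (perm_homology_group K \<pi> (int i)) (homology_group (int i) (top_of_set (realization K)))"
proof (rule natural_map_iso)
  have K: "simplicial_complex K" "locally_finite K"
    using assms(1) by (auto simp: principal_complex_def)
  show "perm_space K \<pi> j \<subseteq> realization K" for j
    using derived_space_eq[OF K, of "perm_complex K \<pi> j"] by (auto simp: perm_space_def perm_complex_def)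
  show "acyclic_pair p (perm_space K \<pi> j) {}" if "j < p" for j p
    by (rule acyclic_perm_space[OF assms(1,2) that])
  show "acyclic_pair p (realization K) (perm_space K \<pi> j)" if "p \<le> j" for j p
    by (rule acyclic_realization_perm_space[OF assms(1,2) that manifold_locally_acyclic[OF assms(1,3)]])
qed

end
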